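(* Let $A_i\in\mathbb{C}_{\rm H}^{m_i}$ and $B_i\in\mathbb{C}^{m_i\times n}$ be given for $i=1,2$, let $\phi(X)=A_1-B_1XB_1^{*}$, and assume that $B_2XB_2^{*}\preccurlyeq A_2$ has a solution $X\in\mathbb{C}_{\rm H}^{n}$. Then there exists $X_0\in\mathbb{C}_{\rm H}^{n}$ such that $$B_2X_0B_2^{*}\preccurlyeq A_2\quad\text{and}\quad \phi(X_0)\preccurlyeq\phi(X)\ \text{ for all } X\in\mathbb{C}_{\rm H}^{n} \text{ with } B_2XB_2^{*}\preccurlyeq A_2$$ if and only if $${\mathscr R}\begin{bmatrix} 0\\ B_1^{*}\end{bmatrix}\subseteq{\mathscr R}\begin{bmatrix} -A_2 & B_2\\ B_2^{*} & 0\end{bmatrix}.$$ In this case, a global minimizer $X_0\in\mathbb{C}_{\rm H}^{n}$ is given by $$X_0=[\,0,\,I_n\,]\begin{bmatrix} -A_2 & B_2\\ B_2^{*} & 0\end{bmatrix}^{\dagger}\begin{bmatrix} 0\\ I_n\end{bmatrix},$$ and the global minimal matrix can uniquely be written as $$\min_{\succcurlyeq}\{\,A_1-B_1XB_1^{*}\mid B_2XB_2^{*}\preccurlyeq A_2,\ X\in\mathbb{C}_{\rm H}^{n}\,\}=A_1-[\,0,\,B_1\,]\begin{bmatrix} -A_2 & B_2\\ B_2^{*} & 0\end{bmatrix}^{\dagger}\begin{bmatrix} 0\\ B_1^{*}\end{bmatrix},$$ which satisfies $$i_{\pm}\!\left(A_1-[\,0,\,B_1\,]\begin{bmatrix} -A_2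 & B_2\\ B_2^{*} & 0\end{bmatrix}^{\dagger}\begin{bmatrix} 0\\ B_1^{*}\end{bmatrix}\right)=i_{\pm}(M)-i_{\pm}\begin{bmatrix} -A_2 & B_2\\ B_2^{*} & 0\end{bmatrix},\qquad M=\begin{bmatrix} A_1 & 0 & B_1\\ 0 & -A_2 & B_2\\ B_1^{*} & B_2^{*} & 0\end{bmatrix}.$$
   Context: $\mathbb{C}_{\rm H}^{m}$ is the set of $m\times m$ complex Hermitian matrices. ${\mathscr R}(\cdot)$ is range (column space), $A^{*}$ is the conjugate transpose, $A^{\dagger}$ is the Moore--Penrose inverse. $i_{+}(A)$ and $i_{-}(A)$ are the numbers of positive and negative eigenvalues of a Hermitian matrix $A$, counted with multiplicity; a formula with $i_{\pm}$ stands for the two formulas with upper and with lower signs. For Hermitian $P,Q$, $P\succcurlyeq Q$ (equivalently $Q\preccurlyeq P$) means $P-Q$ is positive semi-definite (L\"owner partial ordering). $\min_{\succcurlyeq}S$ denotes the least element of a set $S$ of Hermitian matrices in this ordering. *)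

theory Defs
  imports "Jordan_Normal_Form.Schur_Decomposition" "Jordan_Normal_Form.VS_Connect"
begin

definition hermitian_mats :: "nat \<Rightarrow> complex mat set" where
  "hermitian_mats n = {A \<in> carrier_mat n n. mat_adjoint A = A}"

text \<open>The number \<open>(A *\<^sub>v v) \<bullet>c v\<close> is $v^{*}Av$, and \<open>0 \<le> z\<close> for complex \<open>z\<close>
  means that \<open>z\<close> is real and nonnegative.\<close>

definition psd_mat :: "complex mat \<Rightarrow> bool" where
  "psd_mat A \<longleftrightarrow> A \<in> hermitian_mats (dim_row A) \<and>
     (\<forall>v \<in> carrier_vec (dim_row A). 0 \<le> (A *\<^sub>v v) \<bullet>c v)"

definition loewner_le :: "complex mat \<Rightarrow> complex mat \<Rightarrow> bool" (infix "\<preceq>\<^sub>L" 50) where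
  "P \<preceq>\<^sub>L Q \<longleftrightarrow> P \<in> hermitian_mats (dim_row P) \<and> Q \<in> hermitian_mats (dim_row P) \<and>
     psd_mat (Q - P)"

definition loewner_least :: "complex mat set \<Rightarrow> complex mat \<Rightarrow> bool" where
  "loewner_least S P \<longleftrightarrow> P \<in> S \<and> (\<forall>Q \<in> S. P \<preceq>\<^sub>L Q)"

definition loewner_min :: "complex mat set \<Rightarrow> complex mat" where
  "loewner_min S = (THE P. loewner_least S P)"

text \<open>The four Penrose equations; they determine \<open>G\<close> uniquely.\<close>

definition is_pinv :: "complex mat \<Rightarrow> complex mat \<Rightarrow> bool" where
  "is_pinv A G \<longleftrightarrow> G \<in> carrier_mat (dim_col A) (dim_row A) \<and>
     A * G * A = A \<and> G * A * G = G \<and>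
     mat_adjoint (A * G) = A * G \<and> mat_adjoint (G * A) = G * A"

definition pinv :: "complex mat \<Rightarrow> complex mat" where
  "pinv A = (THE G. is_pinv A G)"

text \<open>Eigenvalues are counted with their multiplicity as roots of the characteristic polynomial.\<close>

definition i_plus :: "complex mat \<Rightarrow> nat" where
  "i_plus A = (\<Sum>x | 0 < x \<and> eigenvalue A (complex_of_real x).
     Polynomial.order (complex_of_real x) (char_poly A))"

definition i_minus :: "complex mat \<Rightarrow> nat" where
  "i_minus A = (\<Sum>x | x < 0 \<and> eigenvalue A (complex_of_real x).
     Polynomial.order (complex_of_real x) (char_poly A))"

abbreviation mat_range :: "complex mat \<Rightarrow> complex vec set" where
  "mat_range A \<equiv> vec_space.col_space (dim_row A) A"

definition append_cols :: "'a :: zero mat \<Rightarrow> 'a mat \<Rightarrow> 'a mat" (infixr "@\<^sub>c" 65) where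
  "A @\<^sub>c B = four_block_mat A B (0\<^sub>m 0 (dim_col A)) (0\<^sub>m 0 (dim_col B))"

definition bordered_mat :: "complex mat \<Rightarrow> complex mat \<Rightarrow> complex mat" where
  "bordered_mat A B =
     four_block_mat (- A) B (mat_adjoint B) (0\<^sub>m (dim_col B) (dim_col B))"

text \<open>The \<open>3 \<times> 3\<close> block matrix with rows \<open>[A\<^sub>1, 0, B\<^sub>1]\<close>, \<open>[0, -A\<^sub>2, B\<^sub>2]\<close> and
  \<open>[B\<^sub>1\<^sup>*, B\<^sub>2\<^sup>*, 0]\<close>, grouped as \<open>1 + 2\<close>.\<close>

definition bordered_mat3 ::
  "complex mat \<Rightarrow> complex mat \<Rightarrow> complex mat \<Rightarrow> complex mat \<Rightarrow> complex mat" where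
  "bordered_mat3 A1 A2 B1 B2 =
     four_block_mat
       A1 (0\<^sub>m (dim_row A1) (dim_col A2) @\<^sub>c B1)
       (0\<^sub>m (dim_row A2) (dim_col A1) @\<^sub>r mat_adjoint B1) (bordered_mat A2 B2)"

definition phi :: "complex mat \<Rightarrow> complex mat \<Rightarrow> complex mat \<Rightarrow> complex mat" where
  "phi A B X = A - B * X * mat_adjoint B"

end

theory Submission
  imports Defs
begin

text \<open>Write \<open>N\<close> for the bordered matrix of \<open>A\<^sub>2\<close> and \<open>B\<^sub>2\<close> and $Q_H(v) = v^{*}Hv$. In terms of
quadratic forms, \<open>X\<close> is feasible when $Q_X(B_2^{*}v) \le Q_{A_2}(v)$ for all \<open>v\<close>, and \<open>X\<^sub>0\<close> is a
minimizer when $Q_X(c) \le Q_{X_0}(c)$ for all feasible \<open>X\<close> and all \<open>c\<close> in the range of $B_1^{*}$.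
So everything is decided by how large $Q_X(c)$ can be for feasible \<open>X\<close>.

Suppose \<open>(0, c)\<close> lies in the range of \<open>N\<close>, which means that $A_2y = B_2z$ and $B_2^{*}y = c$ for some
\<open>y\<close> and \<open>z\<close>. Then $Q_X(c) \le Q_{A_2}(y)$ for every feasible \<open>X\<close>, and the lower right block \<open>X\<^sub>0\<close>
of the pseudoinverse of \<open>N\<close> attains this bound (\<open>quad_form_corner_pinv\<close>,
\<open>feasible_le_corner_pinv\<close>). That \<open>X\<^sub>0\<close> itself is feasible is the same computation for
$c = B_2^{*}v$ (\<open>corner_pinv_feasible\<close>); here \<open>(0, c)\<close> is automatically in the range of \<open>N\<close>, because
solvability of the constraint makes every kernel vector \<open>(a, b)\<close> of \<open>N\<close> satisfy \<open>B\<^sub>2b = 0\<close>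
(\<open>bordered_kernel_of_feasible\<close>).

Conversely, if \<open>(0, c)\<close> with \<open>c\<close> in the range of $B_1^{*}$ is not in the range of \<open>N\<close>, there is a
\<open>b\<close> with \<open>B\<^sub>2b = 0\<close> that is not orthogonal to \<open>c\<close>, and adding $bb^{*}$ to a feasible matrix
improves the objective (\<open>range_condition_of_minimizer\<close>).

Under the range condition the minimal matrix is a generalized Schur complement of \<open>N\<close> in the
full block matrix, so that matrix is congruent to the direct sum of the minimum and \<open>N\<close>. The inertia
formula is then Sylvester's law (\<open>i_plus_minus_block_congruence\<close>). Both the law for eigenvalue
counts and the existence of the pseudoinverse rest on the spectral theorem for Hermitian matrices.\<close>

section \<open>Adjoints and Hermitian matrices\<close>

lemma adjoint_dim [simp]:
  "dim_row (mat_adjoint A) = dim_col A" "dim_col (mat_adjoint A) = dim_row A"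
  by (simp_all add: mat_adjoint_def)

lemma adjoint_carrier [simp, intro]: "A \<in> carrier_mat m n \<Longrightarrow> mat_adjoint A \<in> carrier_mat n m"
  by (rule carrier_matI) (simp_all only: adjoint_dim carrier_matD)

lemma adjoint_index [simp]:
  fixes A :: "complex mat"
  assumes "i < dim_col A" "j < dim_row A"
  shows "mat_adjoint A $$ (i, j) = cnj (A $$ (j, i))"
  using assms by (simp add: mat_adjoint_def mat_of_rows_index)

lemma adjoint_adjoint [simp]: "mat_adjoint (mat_adjoint A) = (A :: complex mat)"
  by (rule eq_matI) auto

lemma adjoint_mult:
  fixes A B :: "complex mat"
  assumes "A \<in> carrier_mat m n" "B \<in> carrier_mat n p"
  shows "mat_adjoint (A * B) = mat_adjoint B * mat_adjoint A"
  using assms by (intro eq_matI) (auto simp: scalar_prod_def intro!: sum.cong)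

lemma adjoint_minus:
  fixes A B :: "complex mat"
  assumes "A \<in> carrier_mat m n" "B \<in> carrier_mat m n"
  shows "mat_adjoint (A - B) = mat_adjoint A - mat_adjoint B"
  using assms by (intro eq_matI) auto

lemma adjoint_add:
  fixes A B :: "complex mat"
  assumes "A \<in> carrier_mat m n" "B \<in> carrier_mat m n"
  shows "mat_adjoint (A + B) = mat_adjoint A + mat_adjoint B"
  using assms by (intro eq_matI) auto

lemma adjoint_uminus: "mat_adjoint (- A) = - mat_adjoint (A :: complex mat)"
  by (rule eq_matI) auto

lemma adjoint_one [simp]: "mat_adjoint (1\<^sub>m n :: complex mat) = 1\<^sub>m n"
  by (rule eq_matI) auto

lemma adjoint_zero [simp]: "mat_adjoint (0\<^sub>m m n :: complex mat) = 0\<^sub>m n m"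
  by (rule eq_matI) auto

lemma adjoint_four_block:
  fixes A B C D :: "complex mat"
  assumes "A \<in> carrier_mat m1 n1" "B \<in> carrier_mat m1 n2" "C \<in> carrier_mat m2 n1" "D \<in> carrier_mat m2 n2"
  shows "mat_adjoint (four_block_mat A B C D)
    = four_block_mat (mat_adjoint A) (mat_adjoint C) (mat_adjoint B) (mat_adjoint D)"
  using assms by (intro eq_matI) auto

text \<open>This links the two ways in which the outer block factors are written: the rows
\<open>[0, B]\<close> to the left of the pseudoinverse and the columns to the right of it are adjoint to each
other, so the products around the pseudoinverse are congruences.\<close>

lemma adjoint_zero_append_rows:
  fixes B :: "complex mat"
  shows "mat_adjoint (0\<^sub>m k (dim_row B) @\<^sub>r mat_adjoint B) = 0\<^sub>m (dim_row B) k @\<^sub>c B"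
  by (rule eq_matI) (auto simp: append_rows_def append_cols_def)

lemma cscalar_sum:
  fixes v w :: "complex vec"
  assumes "dim_vec v = n" "dim_vec w = n"
  shows "v \<bullet>c w = (\<Sum>i<n. v $ i * cnj (w $ i))"
  using assms by (simp add: scalar_prod_def atLeast0LessThan)

lemma cscalar_commute:
  fixes v w :: "complex vec"
  assumes "v \<in> carrier_vec n" "w \<in> carrier_vec n"
  shows "v \<bullet>c w = cnj (w \<bullet>c v)"
  using assms by (simp add: cscalar_sum[of _ n] mult.commute)

lemma cscalar_add_left:
  fixes u v w :: "complex vec"
  assumes "u \<in> carrier_vec n" "v \<in> carrier_vec n" "w \<in> carrier_vec n"
  shows "(u + v) \<bullet>c w = u \<bullet>c w + v \<bullet>c w"
  using assms by (simp add: add_scalar_prod_distrib[of _ n])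

lemma cscalar_add_right:
  fixes u v w :: "complex vec"
  assumes "u \<in> carrier_vec n" "v \<in> carrier_vec n" "w \<in> carrier_vec n"
  shows "w \<bullet>c (u + v) = w \<bullet>c u + w \<bullet>c v"
  using assms by (simp add: cscalar_sum[of _ n] algebra_simps sum.distrib)

lemma cscalar_minus_left:
  fixes u v w :: "complex vec"
  assumes "u \<in> carrier_vec n" "v \<in> carrier_vec n" "w \<in> carrier_vec n"
  shows "(u - v) \<bullet>c w = u \<bullet>c w - v \<bullet>c w"
  using assms by (simp add: minus_scalar_prod_distrib[of _ n])

lemma cscalar_append:
  fixes a b c d :: "complex vec"
  assumes "a \<in> carrier_vec m" "c \<in> carrier_vec m" "b \<in> carrier_vec n" "d \<in> carrier_vec n"
  shows "(a @\<^sub>v b) \<bullet>c (c @\<^sub>v d) = a \<bullet>c c + b \<bullet>c d"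
proof -
  have "conjugate (c @\<^sub>v d) = conjugate c @\<^sub>v conjugate d"
    using assms by (intro eq_vecI) auto
  then show ?thesis
    using assms by (simp add: scalar_prod_append[of _ m _ n])
qed

lemma cscalar_self_Re:
  fixes v :: "complex vec"
  shows "v \<bullet>c v = complex_of_real (\<Sum>i<dim_vec v. (cmod (v $ i))\<^sup>2)"
  by (simp add: cscalar_sum[of _ "dim_vec v"] complex_norm_square del: of_real_power)

lemma cscalar_adjoint:
  fixes A :: "complex mat"
  assumes A: "A \<in> carrier_mat m n" and v: "v \<in> carrier_vec n" and w: "w \<in> carrier_vec m"
  shows "(A *\<^sub>v v) \<bullet>c w = v \<bullet>c (mat_adjoint A *\<^sub>v w)"
proof -
  have "(A *\<^sub>v v) \<bullet>c w = (\<Sum>i<m. \<Sum>j<n. A $$ (i, j) * v $ j * cnj (w $ i))"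
    using A v w by (simp add: cscalar_sum[of _ m] scalar_prod_def sum_distrib_right atLeast0LessThan)
  also have "\<dots> = (\<Sum>j<n. \<Sum>i<m. A $$ (i, j) * v $ j * cnj (w $ i))"
    by (rule sum.swap)
  also have "\<dots> = v \<bullet>c (mat_adjoint A *\<^sub>v w)"
    using A v w by (simp add: cscalar_sum[of _ n] scalar_prod_def sum_distrib_left atLeast0LessThan mult_ac)
  finally show ?thesis .
qed

lemma hermitian_carrier: "H \<in> hermitian_mats n \<Longrightarrow> H \<in> carrier_mat n n"
  by (simp add: hermitian_mats_def)

lemma hermitian_adjoint: "H \<in> hermitian_mats n \<Longrightarrow> mat_adjoint H = H"
  by (simp add: hermitian_mats_def)

lemma hermitian_minus: "H \<in> hermitian_mats n \<Longrightarrow> K \<in> hermitian_mats n \<Longrightarrow> H - K \<in> hermitian_mats n"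
  by (auto simp: hermitian_mats_def adjoint_minus)

lemma hermitian_congruence:
  assumes X: "X \<in> hermitian_mats n" and B: "B \<in> carrier_mat m n"
  shows "B * X * mat_adjoint B \<in> hermitian_mats m"
proof -
  note Xc = hermitian_carrier[OF X]
  have "mat_adjoint (B * X * mat_adjoint B) = B * (X * mat_adjoint B)"
    using adjoint_mult[OF mult_carrier_mat[OF B Xc] adjoint_carrier[OF B]] adjoint_mult[OF B Xc]
    by (simp add: hermitian_adjoint[OF X])
  also have "\<dots> = B * X * mat_adjoint B"
    using assoc_mult_mat[OF B Xc adjoint_carrier[OF B]] by simp
  finally show ?thesis
    using B Xc by (auto simp: hermitian_mats_def intro!: mult_carrier_mat)
qed

lemma congruence_mult:
  fixes B E G :: "complex mat"
  assumes B: "B \<in> carrier_mat m n" and E: "E \<in> carrier_mat n k" and G: "G \<in> carrier_mat k k"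
  shows "B * (E * G * mat_adjoint E) * mat_adjoint B = (B * E) * G * mat_adjoint (B * E)"
proof -
  note E' = adjoint_carrier[OF E] and B' = adjoint_carrier[OF B]
  have EG: "E * G \<in> carrier_mat n k" using E G by simp
  have "(B * E) * G * mat_adjoint (B * E) = B * (E * G) * (mat_adjoint E * mat_adjoint B)"
    using adjoint_mult[OF B E] assoc_mult_mat[OF B E G] by simp
  also have "\<dots> = B * (E * G) * mat_adjoint E * mat_adjoint B"
    by (rule assoc_mult_mat[OF mult_carrier_mat[OF B EG] E' B', symmetric])
  also have "B * (E * G) * mat_adjoint E = B * (E * G * mat_adjoint E)"
    by (rule assoc_mult_mat[OF B EG E'])
  finally show ?thesis by simp
qed

lemma cscalar_hermitian:
  assumes H: "H \<in> hermitian_mats n" and "v \<in> carrier_vec n" "w \<in> carrier_vec n"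
  shows "(H *\<^sub>v v) \<bullet>c w = v \<bullet>c (H *\<^sub>v w)"
  using cscalar_adjoint[OF hermitian_carrier[OF H] assms(2,3)] hermitian_adjoint[OF H] by metis

lemma eq_mat_of_mult_vec_eq:
  fixes A :: "complex mat"
  assumes A: "A \<in> carrier_mat m n" and B: "B \<in> carrier_mat m n"
    and eq: "\<And>v. v \<in> carrier_vec n \<Longrightarrow> A *\<^sub>v v = B *\<^sub>v v"
  shows "A = B"
proof (rule eq_matI)
  fix i j assume i: "i < dim_row B" and j: "j < dim_col B"
  have entry: "(M *\<^sub>v unit_vec n j) $ i = M $$ (i, j)" if "M \<in> carrier_mat m n" for M :: "complex mat"
    using that i j B by simp
  show "A $$ (i, j) = B $$ (i, j)"
    using entry[OF A] entry[OF B] eq[of "unit_vec n j"] by simp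
qed (use A B in auto)

section \<open>Quadratic forms and the Loewner order\<close>

text \<open>The value $v^{*}Hv$. It is kept complex because the order on complex numbers used for
positive semidefiniteness already forces real values.\<close>

definition quad_form :: "complex mat \<Rightarrow> complex vec \<Rightarrow> complex" where
  "quad_form H v = (H *\<^sub>v v) \<bullet>c v"

lemma quad_form_congruence:
  assumes X: "X \<in> carrier_mat n n" and B: "B \<in> carrier_mat m n" and v: "v \<in> carrier_vec m"
  shows "quad_form (B * X * mat_adjoint B) v = quad_form X (mat_adjoint B *\<^sub>v v)"
proof -
  define w where "w = mat_adjoint B *\<^sub>v v"
  have w: "w \<in> carrier_vec n" unfolding w_def using B v by (intro mult_mat_vec_carrier) auto
  have BX: "B * X \<in> carrier_mat m n" using B X by simp
  have "B * X * mat_adjoint B *\<^sub>v v = B * X *\<^sub>v w"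
    unfolding w_def by (rule assoc_mult_mat_vec[OF BX adjoint_carrier[OF B] v])
  also have "\<dots> = B *\<^sub>v (X *\<^sub>v w)"
    by (rule assoc_mult_mat_vec[OF B X w])
  finally have "quad_form (B * X * mat_adjoint B) v = (B *\<^sub>v (X *\<^sub>v w)) \<bullet>c v"
    by (simp add: quad_form_def)
  also have "\<dots> = (X *\<^sub>v w) \<bullet>c w"
    using cscalar_adjoint[OF B _ v, of "X *\<^sub>v w"] X w by (simp flip: w_def)
  finally show ?thesis by (simp add: quad_form_def w_def)
qed

lemma quad_form_minus_mat:
  assumes "A \<in> carrier_mat n n" "B \<in> carrier_mat n n" "v \<in> carrier_vec n"
  shows "quad_form (A - B) v = quad_form A v - quad_form B v"
  using assms unfolding quad_form_def
  by (simp add: minus_mult_distrib_mat_vec[of _ n n] cscalar_minus_left[of _ n])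

lemma quad_form_add_mat:
  assumes "A \<in> carrier_mat n n" "B \<in> carrier_mat n n" "v \<in> carrier_vec n"
  shows "quad_form (A + B) v = quad_form A v + quad_form B v"
  using assms unfolding quad_form_def
  by (simp add: add_mult_distrib_mat_vec[of _ n n] cscalar_add_left[of _ n])

lemma quad_form_add_vec:
  assumes H: "H \<in> hermitian_mats n" and v: "v \<in> carrier_vec n" and w: "w \<in> carrier_vec n"
  shows "quad_form H (v + w)
    = quad_form H v + quad_form H w + ((H *\<^sub>v v) \<bullet>c w + cnj ((H *\<^sub>v v) \<bullet>c w))"
proof -
  note Hc = hermitian_carrier[OF H]
  have "(H *\<^sub>v w) \<bullet>c v = cnj ((H *\<^sub>v v) \<bullet>c w)"
    using cscalar_hermitian[OF H w v] cscalar_commute[of w n "H *\<^sub>v v"] Hc v w by auto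
  moreover have "quad_form H (v + w) = (H *\<^sub>v v) \<bullet>c v + (H *\<^sub>v w) \<bullet>c v + ((H *\<^sub>v v) \<bullet>c w + (H *\<^sub>v w) \<bullet>c w)"
    using Hc v w unfolding quad_form_def
    by (simp add: mult_add_distrib_mat_vec[of _ n n] cscalar_add_right[of _ n] cscalar_add_left[of _ n])
  ultimately show ?thesis by (simp add: quad_form_def)
qed

lemma loewner_le_iff_quad_form:
  assumes "P \<in> hermitian_mats n" "Q \<in> hermitian_mats n"
  shows "P \<preceq>\<^sub>L Q \<longleftrightarrow> (\<forall>v \<in> carrier_vec n. quad_form P v \<le> quad_form Q v)"
proof -
  have "dim_row P = n" "dim_row (Q - P) = n" "Q - P \<in> hermitian_mats n"
    using assms hermitian_minus by (auto simp: hermitian_mats_def)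
  then have "P \<preceq>\<^sub>L Q \<longleftrightarrow> (\<forall>v \<in> carrier_vec n. 0 \<le> quad_form (Q - P) v)"
    using assms by (simp add: loewner_le_def psd_mat_def quad_form_def)
  then show ?thesis
    using assms by (simp add: quad_form_minus_mat[of _ n] hermitian_carrier)
qed

text \<open>Along the line $v + tHv$ the form takes the value $2t\,|Hv|^2 + t^2\,Q_H(Hv)$. It has no constant
term, so for small negative \<open>t\<close> the linear term would make it negative unless \<open>Hv = 0\<close>.\<close>

lemma psd_quad_form_zero_imp_kernel:
  assumes H: "H \<in> hermitian_mats n"
    and psd: "\<And>v. v \<in> carrier_vec n \<Longrightarrow> 0 \<le> quad_form H v"
    and v: "v \<in> carrier_vec n" and zero: "quad_form H v = 0"
  shows "H *\<^sub>v v = 0\<^sub>v n"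
proof -
  note Hc = hermitian_carrier[OF H]
  define u where "u = H *\<^sub>v v"
  have u: "u \<in> carrier_vec n" using Hc v by (simp add: u_def)
  define a where "a = Re (u \<bullet>c u)"
  define b where "b = Re (quad_form H u)"
  have uu: "u \<bullet>c u = complex_of_real a"
    by (simp add: a_def cscalar_self_Re)
  have ineq: "0 \<le> t\<^sup>2 * b + 2 * t * a" for t :: real
  proof -
    have tu: "of_real t \<cdot>\<^sub>v u \<in> carrier_vec n" using u by simp
    have "quad_form H (of_real t \<cdot>\<^sub>v u) = of_real (t\<^sup>2) * quad_form H u"
      using Hc u unfolding quad_form_def
      by (simp add: mult_mat_vec[of _ n n] conjugate_smult_vec power2_eq_square)
    moreover have "(H *\<^sub>v v) \<bullet>c (of_real t \<cdot>\<^sub>v u) = of_real (t * a)"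
      using u by (simp add: conjugate_smult_vec uu flip: u_def)
    ultimately have "quad_form H (v + of_real t \<cdot>\<^sub>v u) = of_real (t\<^sup>2) * quad_form H u + of_real (2 * t * a)"
      using quad_form_add_vec[OF H v tu] zero by simp
    moreover have "0 \<le> quad_form H (v + of_real t \<cdot>\<^sub>v u)"
      using psd v tu by simp
    ultimately show ?thesis by (simp add: less_eq_complex_def b_def)
  qed
  have "a \<ge> 0"
    by (simp add: a_def cscalar_self_Re sum_nonneg)
  have "a \<le> 0"
  proof (rule ccontr)
    assume "\<not> a \<le> 0"
    then have a: "a > 0" by simp
    have "0 \<le> b" using psd[OF u] by (simp add: b_def less_eq_complex_def)
    \<comment> \<open>The parameter is small enough for the linear term to win, and the shift by 1 covers \<open>b = 0\<close>.\<close>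
    have "0 \<le> (a / (b + 1))\<^sup>2 * b - 2 * (a / (b + 1)) * a"
      using ineq[of "- a / (b + 1)"] by simp
    also have "\<dots> = (a / (b + 1)) * (a * (b / (b + 1)) - 2 * a)"
      by (simp add: power2_eq_square algebra_simps)
    also have "\<dots> < 0"
    proof (rule mult_pos_neg)
      have "a * (b / (b + 1)) \<le> a * 1"
        using a \<open>0 \<le> b\<close> by (intro mult_left_mono) auto
      then show "a * (b / (b + 1)) - 2 * a < 0" using a by simp
    qed (use a \<open>0 \<le> b\<close> in auto)
    finally show False by simp
  qed
  then have "u \<bullet>c u = 0" using uu \<open>a \<ge> 0\<close> by simp
  then show ?thesis using u by (simp add: u_def)
qed

text \<open>If both differences are positive semidefinite, the form of \<open>P - Q\<close> vanishes identically, and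
then every vector lies in the kernel of \<open>P - Q\<close>.\<close>

lemma loewner_antisym:
  assumes "P \<preceq>\<^sub>L Q" "Q \<preceq>\<^sub>L P"
  shows "P = Q"
proof -
  define n where "n = dim_row P"
  have P: "P \<in> hermitian_mats n" and Q: "Q \<in> hermitian_mats n"
    using assms(1) by (simp_all add: loewner_le_def n_def)
  note Pc = hermitian_carrier[OF P] and Qc = hermitian_carrier[OF Q]
  have zero: "quad_form (P - Q) v = 0" if "v \<in> carrier_vec n" for v
    using assms that P Q Pc Qc
    by (force simp: quad_form_minus_mat[of _ n] loewner_le_iff_quad_form[OF P Q] loewner_le_iff_quad_form[OF Q P])
  have "(P - Q) *\<^sub>v v = 0\<^sub>v n" if "v \<in> carrier_vec n" for v
    using psd_quad_form_zero_imp_kernel[OF hermitian_minus[OF P Q] _ that] zero that by simp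
  then have "P - Q = 0\<^sub>m n n"
    using Pc Qc by (intro eq_mat_of_mult_vec_eq[of _ n n]) auto
  then have "(P - Q) + Q = Q" using Qc by simp
  then show ?thesis
    using Pc Qc by (simp add: minus_add_uminus_mat[of P n n] assoc_add_mat[of _ n n])
qed

section \<open>Unitary diagonalization\<close>

text \<open>Gram-Schmidt turns a basis that starts with \<open>v\<close> into an orthogonal one that still starts with
\<open>v\<close>; dividing each column by its norm leaves the unit vector \<open>v\<close> in place.\<close>

lemma unitary_with_first_column:
  fixes v :: "complex vec"
  assumes v: "v \<in> carrier_vec n" and unit: "v \<bullet>c v = 1"
  obtains W where "W \<in> carrier_mat n n" "mat_adjoint W * W = 1\<^sub>m n" "col W 0 = v"
proof -
  interpret cof_vec_space n "TYPE(complex)" .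
  have v0: "v \<noteq> 0\<^sub>v n" using unit v conjugate_square_eq_0_vec[OF v] by auto
  have n: "n > 0" using v v0 by (cases n) auto
  define bs where "bs = basis_completion v"
  define ws where "ws = gram_schmidt n bs"
  from basis_completion[OF v v0, folded bs_def]
  have dist: "distinct bs" and indep: "\<not> lin_dep (set bs)" and bs: "set bs \<subseteq> carrier_vec n"
    and hd: "hd bs = v" and len: "length bs = n" by auto
  from gram_schmidt_result[OF bs dist indep refl, folded ws_def]
  have ws: "set ws \<subseteq> carrier_vec n" "corthogonal ws" "length ws = n" by (auto simp: len)
  have "bs = v # tl bs" using hd len n by (cases bs) auto
  then have "hd ws = v" using gram_schmidt_hd[OF v, of "tl bs"] by (simp add: ws_def)
  then have ws0: "ws ! 0 = v" using ws(3) n by (cases ws) auto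
  have wsc: "ws ! j \<in> carrier_vec n" if "j < n" for j using that ws by auto
  define r where "r = (\<lambda>j. sqrt (Re (ws ! j \<bullet>c ws ! j)))"
  have nonzero: "ws ! j \<bullet>c ws ! j \<noteq> 0" if "j < n" for j
    using corthogonalD[OF ws(2), of j j] ws(3) that by simp
  have r: "complex_of_real (r j) * complex_of_real (r j) = ws ! j \<bullet>c ws ! j" "r j \<noteq> 0" if "j < n" for j
  proof -
    have pos: "0 \<le> Re (ws ! j \<bullet>c ws ! j)" by (simp add: cscalar_self_Re sum_nonneg)
    then have "complex_of_real (r j * r j) = complex_of_real (Re (ws ! j \<bullet>c ws ! j))"
      by (simp only: r_def real_sqrt_mult_self abs_of_nonneg)
    also have "\<dots> = ws ! j \<bullet>c ws ! j" by (simp add: cscalar_self_Re)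
    finally show "complex_of_real (r j) * complex_of_real (r j) = ws ! j \<bullet>c ws ! j" by simp
    then show "r j \<noteq> 0" using nonzero[OF that] by auto
  qed
  define W where "W = mat n n (\<lambda>(i, j). ws ! j $ i / complex_of_real (r j))"
  have W: "W \<in> carrier_mat n n" by (simp add: W_def)
  show ?thesis
  proof (rule that[OF W])
    show "mat_adjoint W * W = 1\<^sub>m n"
    proof (rule eq_matI)
      fix i j assume "i < dim_row (1\<^sub>m n :: complex mat)" "j < dim_col (1\<^sub>m n :: complex mat)"
      then have i: "i < n" and j: "j < n" by auto
      have "(mat_adjoint W * W) $$ (i, j) = (\<Sum>k<n. cnj (W $$ (k, i)) * W $$ (k, j))"
        using W i j by (simp add: scalar_prod_def atLeast0LessThan)
      also have "\<dots> = (\<Sum>k<n. ws ! j $ k * cnj (ws ! i $ k)) / complex_of_real (r i * r j)"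
        using i j by (simp add: W_def sum_divide_distrib mult_ac)
      also have "\<dots> = (ws ! j \<bullet>c ws ! i) / complex_of_real (r i * r j)"
        using wsc i j by (simp add: cscalar_sum[of _ n])
      also have "\<dots> = (if i = j then 1 else 0)"
        using corthogonalD[OF ws(2), of j i] ws(3) i j r[OF i] nonzero[OF i] by auto
      finally show "(mat_adjoint W * W) $$ (i, j) = (1\<^sub>m n :: complex mat) $$ (i, j)"
        using i j by simp
    qed (use W in auto)
    show "col W 0 = v"
      using v n by (intro eq_vecI) (auto simp: W_def ws0 r_def unit)
  qed
qed

abbreviation real_diag :: "nat \<Rightarrow> (nat \<Rightarrow> real) \<Rightarrow> complex mat" where
  "real_diag n d \<equiv> mat_diag n (\<lambda>i. complex_of_real (d i))"

lemma adjoint_real_diag [simp]: "mat_adjoint (real_diag n d) = real_diag n d"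
  by (rule eq_matI) (auto simp: mat_diag_def)

text \<open>The spectral theorem, by deflation. In an orthonormal basis whose first vector is an eigenvector,
the first column of the matrix is zero below the diagonal, hence, since the matrix stays Hermitian,
so is the first row, and the remaining block is a smaller Hermitian matrix.\<close>

theorem hermitian_unitary_diagonalization:
  assumes "A \<in> hermitian_mats n"
  shows "\<exists>U \<in> carrier_mat n n. \<exists>d. mat_adjoint U * U = 1\<^sub>m n \<and> A = U * real_diag n d * mat_adjoint U"
  using assms
proof (induction n arbitrary: A)
  case 0
  then have "A = 1\<^sub>m 0 * real_diag 0 (\<lambda>_. 0) * mat_adjoint (1\<^sub>m 0)"
    by (intro eq_matI) (auto simp: hermitian_mats_def)
  then show ?case by (intro bexI[of _ "1\<^sub>m 0"] exI[of _ "\<lambda>_. 0"] conjI) simp_all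
next
  case (Suc m)
  let ?n = "Suc m"
  note A = hermitian_carrier[OF Suc.prems]
  obtain as where as: "char_poly A = (\<Prod>a\<leftarrow>as. [:- a, 1:])" "length as = ?n"
    using char_poly_factorized[OF A] by blast
  then obtain e as' where "as = e # as'" by (cases as) auto
  then have "eigenvalue A e" using as(1) by (simp add: eigenvalue_root_char_poly[OF A])
  then obtain v0 where v0: "v0 \<in> carrier_vec ?n" "v0 \<noteq> 0\<^sub>v ?n" "A *\<^sub>v v0 = e \<cdot>\<^sub>v v0"
    using A by (auto simp: eigenvalue_def eigenvector_def)
  define s where "s = sqrt (Re (v0 \<bullet>c v0))"
  define v where "v = complex_of_real (1 / s) \<cdot>\<^sub>v v0"
  have v: "v \<in> carrier_vec ?n" using v0 by (simp add: v_def)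
  have v0v0: "v0 \<bullet>c v0 = complex_of_real (Re (v0 \<bullet>c v0))" by (simp add: cscalar_self_Re)
  have "0 \<le> Re (v0 \<bullet>c v0)" by (simp add: cscalar_self_Re sum_nonneg)
  then have ss: "s * s = Re (v0 \<bullet>c v0)" by (simp add: s_def)
  have "s * s \<noteq> 0" using v0v0 v0(1,2) ss conjugate_square_eq_0_vec[OF v0(1)] by auto
  then have s0: "s \<noteq> 0" by simp
  have unit: "v \<bullet>c v = 1"
  proof -
    have "v \<bullet>c v = complex_of_real (1 / s * (1 / s)) * (v0 \<bullet>c v0)"
      using v0 by (simp add: v_def conjugate_smult_vec)
    also have "\<dots> = complex_of_real (1 / s * (1 / s) * (s * s))"
      by (subst v0v0) (simp add: ss)
    also have "\<dots> = 1" using s0 by simp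
    finally show ?thesis .
  qed
  have eig: "A *\<^sub>v v = e \<cdot>\<^sub>v v"
    using A v0 by (simp add: v_def mult_mat_vec[of _ ?n ?n] smult_smult_assoc mult.commute)
  have "cnj e = e"
  proof -
    have "e = (A *\<^sub>v v) \<bullet>c v" using v unit by (simp add: eig)
    also have "\<dots> = v \<bullet>c (A *\<^sub>v v)" using cscalar_hermitian[OF Suc.prems v v] .
    also have "\<dots> = cnj e" using v unit by (simp add: eig conjugate_smult_vec)
    finally show ?thesis by simp
  qed
  then have e: "e = complex_of_real (Re e)"
    by (simp add: complex_eq_iff)
  obtain W where W: "W \<in> carrier_mat ?n ?n" and WW: "mat_adjoint W * W = 1\<^sub>m ?n" and W0: "col W 0 = v"
    using unitary_with_first_column[OF v unit] .
  note W' = adjoint_carrier[OF W]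
  have WW': "W * mat_adjoint W = 1\<^sub>m ?n" using mat_mult_left_right_inverse[OF W' W WW] .
  define H where "H = mat_adjoint W * A * W"
  have H: "H \<in> hermitian_mats ?n"
    using hermitian_congruence[OF Suc.prems W'] by (simp add: H_def)
  note Hc = hermitian_carrier[OF H]
  have A_eq: "A = W * H * mat_adjoint W"
  proof -
    have "W * H * mat_adjoint W = W * (mat_adjoint W * (A * W)) * mat_adjoint W"
      using A W W' by (simp add: H_def assoc_mult_mat[of _ ?n ?n _ ?n _ ?n])
    also have "\<dots> = (W * mat_adjoint W) * A * (W * mat_adjoint W)"
      using A W W' by (simp add: assoc_mult_mat[of _ ?n ?n _ ?n _ ?n] mult_carrier_mat[of _ ?n ?n _ ?n])
    finally show ?thesis using A by (simp add: WW')
  qed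
  have H0: "H $$ (i, 0) = (if i = 0 then e else 0)" if "i < ?n" for i
  proof -
    have "col H 0 = mat_adjoint W *\<^sub>v (A *\<^sub>v col W 0)"
      unfolding H_def assoc_mult_mat[OF W' A W]
      by (simp only: col_mult2[OF W' mult_carrier_mat[OF A W]] col_mult2[OF A W] zero_less_Suc)
    also have "\<dots> = e \<cdot>\<^sub>v (mat_adjoint W *\<^sub>v col W 0)"
      using W' v by (simp add: W0 eig mult_mat_vec[of _ ?n ?n])
    also have "mat_adjoint W *\<^sub>v col W 0 = col (mat_adjoint W * W) 0"
      by (simp only: col_mult2[OF W' W] zero_less_Suc)
    finally have "col H 0 $ i = (e \<cdot>\<^sub>v col (1\<^sub>m ?n) 0) $ i" by (simp add: WW)
    then show ?thesis using that Hc by simp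
  qed
  have H_sym: "H $$ (i, j) = cnj (H $$ (j, i))" if "i < ?n" "j < ?n" for i j
    using that Hc hermitian_adjoint[OF H] adjoint_index[of i H j] by simp
  define H3 where "H3 = mat m m (\<lambda>(i, j). H $$ (Suc i, Suc j))"
  have H3: "H3 \<in> hermitian_mats m"
    unfolding hermitian_mats_def
    by (auto simp: H3_def intro!: eq_matI H_sym[symmetric])
  define E where "E = mat 1 1 (\<lambda>_. e)"
  have E: "E \<in> carrier_mat 1 1" by (simp add: E_def)
  have H_block: "H = four_block_mat E (0\<^sub>m 1 m) (0\<^sub>m m 1) H3"
  proof (rule eq_matI)
    fix i j
    assume "i < dim_row (four_block_mat E (0\<^sub>m 1 m) (0\<^sub>m m 1) H3)"
      "j < dim_col (four_block_mat E (0\<^sub>m 1 m) (0\<^sub>m m 1) H3)"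
    then have i: "i < ?n" and j: "j < ?n" by (auto simp: E_def H3_def)
    show "H $$ (i, j) = four_block_mat E (0\<^sub>m 1 m) (0\<^sub>m m 1) H3 $$ (i, j)"
      using i j H0[OF i] H0[OF j] H_sym[OF i j] by (cases i; cases j) (auto simp: E_def H3_def)
  qed (use Hc in \<open>auto simp: E_def H3_def\<close>)
  obtain U3 d3 where U3: "U3 \<in> carrier_mat m m" and UU3: "mat_adjoint U3 * U3 = 1\<^sub>m m"
    and H3_eq: "H3 = U3 * real_diag m d3 * mat_adjoint U3"
    using Suc.IH[OF H3] by blast
  define V where "V = four_block_mat (1\<^sub>m 1) (0\<^sub>m 1 m) (0\<^sub>m m 1) U3"
  have V: "V \<in> carrier_mat ?n ?n" using four_block_carrier_mat[OF one_carrier_mat[of 1] U3] by (simp add: V_def)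
  have V': "mat_adjoint V = four_block_mat (1\<^sub>m 1) (0\<^sub>m 1 m) (0\<^sub>m m 1) (mat_adjoint U3)"
    using U3 by (simp add: V_def adjoint_four_block[of _ 1 1 _ m _ m])
  define d where "d = case_nat (Re e) d3"
  have D: "real_diag ?n d = four_block_mat E (0\<^sub>m 1 m) (0\<^sub>m m 1) (real_diag m d3)"
  proof (rule eq_matI)
    fix i j
    assume "i < dim_row (four_block_mat E (0\<^sub>m 1 m) (0\<^sub>m m 1) (real_diag m d3))"
      "j < dim_col (four_block_mat E (0\<^sub>m 1 m) (0\<^sub>m m 1) (real_diag m d3))"
    then have "i < ?n" "j < ?n" by (auto simp: E_def mat_diag_def)
    then show "real_diag ?n d $$ (i, j) = four_block_mat E (0\<^sub>m 1 m) (0\<^sub>m m 1) (real_diag m d3) $$ (i, j)"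
      using e by (cases i; cases j) (auto simp: E_def mat_diag_def d_def)
  qed (auto simp: E_def mat_diag_def)
  have VV: "mat_adjoint V * V = 1\<^sub>m ?n"
    unfolding V' using U3 UU3
    by (simp add: V_def mult_four_block_mat[of _ 1 1 _ m _ m _ _ 1 _ m])
  have H_eq: "H = V * real_diag ?n d * mat_adjoint V"
    unfolding V' unfolding D V_def using U3 E
    by (simp add: mult_four_block_mat[of _ 1 1 _ m _ m _ _ 1 _ m] mult_carrier_mat[of _ m m _ m]
        left_mult_zero_mat[of _ m m] right_mult_zero_mat[of _ m m] H_block H3_eq)
  note V'c = adjoint_carrier[OF V]
  have Dc: "real_diag ?n d \<in> carrier_mat ?n ?n" by simp
  define U where "U = W * V"
  have U: "U \<in> carrier_mat ?n ?n" using W V by (simp add: U_def)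
  have U': "mat_adjoint U = mat_adjoint V * mat_adjoint W" using adjoint_mult[OF W V] by (simp add: U_def)
  have "mat_adjoint U * U = mat_adjoint V * (mat_adjoint W * W) * V"
    unfolding U' using W V W' V'c
    by (simp add: U_def assoc_mult_mat[of _ ?n ?n _ ?n _ ?n] mult_carrier_mat[of _ ?n ?n _ ?n])
  also have "\<dots> = 1\<^sub>m ?n" by (simp add: WW VV right_mult_one_mat[OF V'c])
  finally have UU: "mat_adjoint U * U = 1\<^sub>m ?n" .
  have "A = U * real_diag ?n d * mat_adjoint U"
    unfolding U' unfolding A_eq H_eq U_def using W V W' V'c Dc
    by (simp add: assoc_mult_mat[of _ ?n ?n _ ?n _ ?n] mult_carrier_mat[of _ ?n ?n _ ?n])
  then show ?case using U UU by blast
qed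

section \<open>The pseudoinverse of a Hermitian matrix\<close>

text \<open>Two solutions of the Penrose equations induce the same projections: $AH = AGAH = (AHAG)^{*} = AG$,
because all the factors \<open>AG\<close> and \<open>AH\<close> are self-adjoint, and similarly $HA = GA$.\<close>

lemma pinv_unique:
  assumes G: "is_pinv A G" and H: "is_pinv A H"
  shows "G = H"
proof -
  define m n where "m = dim_row A" and "n = dim_col A"
  have A: "A \<in> carrier_mat m n" by (simp add: m_def n_def)
  have Gc: "G \<in> carrier_mat n m" and Hc: "H \<in> carrier_mat n m"
    using G H by (simp_all add: is_pinv_def m_def n_def)
  have AG: "A * G \<in> carrier_mat m m" and AH: "A * H \<in> carrier_mat m m"
    and GA: "G * A \<in> carrier_mat n n" and HA: "H * A \<in> carrier_mat n n"
    using A Gc Hc by auto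
  have "A * H = (A * G * A) * H" using G by (simp add: is_pinv_def)
  also have "\<dots> = (A * G) * (A * H)" using A Gc Hc AG by (intro assoc_mult_mat) auto
  also have "\<dots> = mat_adjoint ((A * H) * (A * G))"
    using G H adjoint_mult[OF AH AG] by (simp add: is_pinv_def)
  also have "(A * H) * (A * G) = (A * H * A) * G" using A Gc AH by (intro assoc_mult_mat[symmetric]) auto
  also have "\<dots> = A * G" using H by (simp add: is_pinv_def)
  also have "mat_adjoint (A * G) = A * G" using G by (simp add: is_pinv_def)
  finally have AHAG: "A * H = A * G" .
  have "H * A = H * (A * G * A)" using G by (simp add: is_pinv_def)
  also have "\<dots> = (H * A) * (G * A)" using A Gc Hc GA
    by (simp add: assoc_mult_mat[of A m n G m A n] assoc_mult_mat[of H n m A n "G * A" n])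
  also have "\<dots> = mat_adjoint ((G * A) * (H * A))"
    using G H adjoint_mult[OF GA HA] by (simp add: is_pinv_def)
  also have "(G * A) * (H * A) = G * (A * H * A)" using A Gc Hc HA
    by (simp add: assoc_mult_mat[of A m n H m A n] assoc_mult_mat[of G n m A n "H * A" n])
  also have "\<dots> = G * A" using H by (simp add: is_pinv_def)
  also have "mat_adjoint (G * A) = G * A" using G by (simp add: is_pinv_def)
  finally have HAGA: "H * A = G * A" .
  have "G = G * A * G" using G by (simp add: is_pinv_def)
  also have "\<dots> = H * (A * G)" using A Gc Hc by (simp flip: HAGA)
  also have "\<dots> = H * A * H" using A Gc Hc by (simp flip: AHAG)
  also have "\<dots> = H" using H by (simp add: is_pinv_def)
  finally show ?thesis .
qed

lemma is_pinv_pinvI: "is_pinv A G \<Longrightarrow> is_pinv A (pinv A)"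
  unfolding pinv_def by (rule theI2[of _ G]) (auto intro: pinv_unique)

text \<open>In a diagonalizing basis the inverse is taken eigenvalue by eigenvalue. The convention that
the inverse of zero is zero makes this the pseudoinverse also in the singular case.\<close>

lemma is_pinv_pinv_hermitian:
  assumes "A \<in> hermitian_mats n"
  shows "is_pinv A (pinv A)"
proof -
  obtain U d where U: "U \<in> carrier_mat n n" and UU: "mat_adjoint U * U = 1\<^sub>m n"
    and A: "A = U * real_diag n d * mat_adjoint U"
    using hermitian_unitary_diagonalization[OF assms] by blast
  note U' = adjoint_carrier[OF U]
  let ?F = "\<lambda>f. U * real_diag n f * mat_adjoint U"
  have Fc: "?F f \<in> carrier_mat n n" for f
    using U U' by (simp add: mult_carrier_mat[of _ n n _ n])
  have mult: "?F f * ?F g = ?F (\<lambda>i. f i * g i)" for f g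
  proof -
    have "?F f * ?F g = U * real_diag n f * (mat_adjoint U * U) * real_diag n g * mat_adjoint U"
      using U U' by (simp add: assoc_mult_mat[of _ n n _ n _ n] mult_carrier_mat[of _ n n _ n])
    also have "\<dots> = U * (real_diag n f * real_diag n g) * mat_adjoint U"
      using U U' by (simp add: UU assoc_mult_mat[of _ n n _ n _ n] mult_carrier_mat[of _ n n _ n]
          left_mult_one_mat[of _ n n] del: mat_diag_diag)
    finally show ?thesis by simp
  qed
  have adj: "mat_adjoint (?F f) = ?F f" for f
    using hermitian_congruence[of "real_diag n f" n U n] U by (simp add: hermitian_mats_def)
  have inv: "d i * inverse (d i) * d i = d i" "inverse (d i) * d i * inverse (d i) = inverse (d i)" for i
    by (cases "d i = 0"; simp)+
  have "is_pinv A (?F (\<lambda>i. inverse (d i)))"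
    unfolding is_pinv_def A mult adj inv
    using Fc[of d] Fc[of "\<lambda>i. inverse (d i)"] by (intro conjI refl) (simp only: carrier_matD)
  then show ?thesis by (rule is_pinv_pinvI)
qed

lemma pinv_hermitian:
  assumes A: "A \<in> hermitian_mats n"
  shows "pinv A \<in> hermitian_mats n"
proof -
  note Ac = hermitian_carrier[OF A]
  have G: "is_pinv A (pinv A)" by (rule is_pinv_pinv_hermitian[OF A])
  then have Gc: "pinv A \<in> carrier_mat n n" using Ac by (simp add: is_pinv_def)
  let ?G = "pinv A"
  note A' = hermitian_adjoint[OF A]
  note G' = adjoint_carrier[OF Gc]
  have AG: "mat_adjoint (A * ?G) = mat_adjoint ?G * A" "mat_adjoint (?G * A) = A * mat_adjoint ?G"
    using adjoint_mult[OF Ac Gc] adjoint_mult[OF Gc Ac] by (simp_all add: A')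
  have "is_pinv A (mat_adjoint ?G)"
    unfolding is_pinv_def
  proof (intro conjI)
    have "mat_adjoint (A * ?G * A) = A * mat_adjoint ?G * A"
      using adjoint_mult[OF mult_carrier_mat[OF Ac Gc] Ac] assoc_mult_mat[OF Ac G' Ac] by (simp add: A' AG)
    then show "A * mat_adjoint ?G * A = A" using G by (simp add: is_pinv_def A')
    have "mat_adjoint (?G * A * ?G) = mat_adjoint ?G * A * mat_adjoint ?G"
      using adjoint_mult[OF mult_carrier_mat[OF Gc Ac] Gc] assoc_mult_mat[OF G' Ac G'] by (simp add: AG)
    then show "mat_adjoint ?G * A * mat_adjoint ?G = mat_adjoint ?G" using G by (simp add: is_pinv_def)
    show "mat_adjoint (A * mat_adjoint ?G) = A * mat_adjoint ?G"
       "mat_adjoint (mat_adjoint ?G * A) = mat_adjoint ?G * A"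
      using G by (simp_all add: is_pinv_def flip: AG)
    show "mat_adjoint ?G \<in> carrier_mat (dim_col A) (dim_row A)" using Gc Ac by auto
  qed
  from pinv_unique[OF this G] show ?thesis using Gc by (simp add: hermitian_mats_def)
qed

text \<open>The matrix \<open>N\<close> times its pseudoinverse is a self-adjoint projection that \<open>N\<close> does not
see, so the residual \<open>w - p\<close> lies in the kernel of \<open>N\<close>. Both \<open>w\<close> and \<open>p\<close> are orthogonal to
the kernel, so the residual is orthogonal to itself. This is the nontrivial half of the statement that
the range of a Hermitian matrix is the orthogonal complement of its kernel.\<close>

lemma mult_pinv_of_orth_kernel:
  assumes N: "N \<in> hermitian_mats k" and w: "w \<in> carrier_vec k"
    and orth: "\<And>u. u \<in> carrier_vec k \<Longrightarrow> N *\<^sub>v u = 0\<^sub>v k \<Longrightarrow> w \<bullet>c u = 0"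
  shows "N *\<^sub>v (pinv N *\<^sub>v w) = w"
proof -
  note Nc = hermitian_carrier[OF N]
  have G: "is_pinv N (pinv N)" by (rule is_pinv_pinv_hermitian[OF N])
  have Gc: "pinv N \<in> carrier_mat k k" using pinv_hermitian[OF N] by (rule hermitian_carrier)
  define p where "p = N *\<^sub>v (pinv N *\<^sub>v w)"
  have NG: "N * pinv N \<in> hermitian_mats k" using G Nc Gc by (simp add: is_pinv_def hermitian_mats_def)
  note NGc = hermitian_carrier[OF NG]
  have p_eq: "p = (N * pinv N) *\<^sub>v w" using Nc Gc w by (simp add: p_def)
  have p: "p \<in> carrier_vec k" using Nc Gc w unfolding p_def by (metis mult_mat_vec_carrier)
  have NNG: "N * (N * pinv N) = N"
  proof -
    have "mat_adjoint (N * pinv N * N) = N * (N * pinv N)"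
      using adjoint_mult[OF NGc Nc] hermitian_adjoint[OF N] hermitian_adjoint[OF NG] by simp
    then show ?thesis using G hermitian_adjoint[OF N] by (simp add: is_pinv_def)
  qed
  have "N *\<^sub>v p = N *\<^sub>v w"
    using assoc_mult_mat_vec[OF Nc NGc w] by (simp add: p_eq NNG)
  then have "N *\<^sub>v (w - p) = 0\<^sub>v k"
    using Nc w p by (simp add: mult_minus_distrib_mat_vec[of _ k k])
  moreover have "p \<bullet>c u = 0" if u: "u \<in> carrier_vec k" and "N *\<^sub>v u = 0\<^sub>v k" for u
  proof -
    have "p \<bullet>c u = (pinv N *\<^sub>v w) \<bullet>c (N *\<^sub>v u)"
      unfolding p_def using cscalar_hermitian[OF N _ u] Gc w by (metis mult_mat_vec_carrier)
    also have "\<dots> = 0" using that Gc w by simp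
    finally show ?thesis .
  qed
  ultimately have "(w - p) \<bullet>c (w - p) = 0"
    using orth w p by (simp add: cscalar_minus_left[of _ k])
  then have diff: "w - p = 0\<^sub>v k"
    using conjugate_square_eq_0_vec[of "w - p" k] w p by simp
  have "w = p"
  proof (rule eq_vecI)
    fix i assume "i < dim_vec p"
    then show "w $ i = p $ i" using arg_cong[OF diff, of "\<lambda>u. u $ i"] w p by simp
  qed (use w p in simp)
  then show ?thesis by (simp add: p_def)
qed

section \<open>Inertia\<close>

lemma order_prod_linear_factors:
  fixes e :: "nat \<Rightarrow> 'a :: field"
  assumes "finite S"
  shows "Polynomial.order x (\<Prod>i\<in>S. [:- e i, 1:]) = card {i \<in> S. e i = x}"
  using assms
proof (induction S rule: finite_induct)
  case empty
  then show ?case by (simp add: order_0I)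
next
  case (insert j S)
  have "Polynomial.order x [:- e j, 1:] = (if e j = x then 1 else 0)"
    using order_power_n_n[of x 1] by (auto intro: order_0I)
  moreover have "Polynomial.order x (\<Prod>i\<in>insert j S. [:- e i, 1:])
    = Polynomial.order x [:- e j, 1:] + Polynomial.order x (\<Prod>i\<in>S. [:- e i, 1:])"
  proof -
    have "(\<Prod>i\<in>insert j S. [:- e i, 1:]) \<noteq> 0"
      using insert.hyps(1) by (subst prod_zero_iff) auto
    then show ?thesis
      using insert.hyps by (simp add: order_mult del: mult_pCons_left)
  qed
  moreover have "{i \<in> insert j S. e i = x} = (if e j = x then insert j {i \<in> S. e i = x} else {i \<in> S. e i = x})"
    by auto
  ultimately show ?case
    using insert by simp
qed

lemma sum_order_char_poly_diagonalized:
  fixes U :: "complex mat"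
  assumes U: "U \<in> carrier_mat n n" and UU: "mat_adjoint U * U = 1\<^sub>m n"
    and A: "A = U * real_diag n e * mat_adjoint U"
  shows "(\<Sum>x | P x \<and> eigenvalue A (complex_of_real x). Polynomial.order (complex_of_real x) (char_poly A))
    = card {i. i < n \<and> P (e i)}"
proof -
  note U' = adjoint_carrier[OF U]
  have Dc: "real_diag n e \<in> carrier_mat n n" by simp
  have Ac: "A \<in> carrier_mat n n" using U U' by (simp add: A mult_carrier_mat[of _ n n _ n])
  have "similar_mat A (real_diag n e)"
    unfolding similar_mat_def
    by (intro exI, rule similar_mat_witI[OF mat_mult_left_right_inverse[OF U' U UU] UU A Ac Dc U U'])
  then have "char_poly A = char_poly (real_diag n e)" by (rule char_poly_similar)
  also have "\<dots> = (\<Prod>a\<leftarrow>diag_mat (real_diag n e). [:- a, 1:])"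
    by (rule char_poly_upper_triangular[OF Dc]) (auto simp: mat_diag_def)
  also have "diag_mat (real_diag n e) = map (\<lambda>i. complex_of_real (e i)) [0..<n]"
    by (auto simp: diag_mat_def mat_diag_def)
  also have "(\<Prod>a\<leftarrow>map (\<lambda>i. complex_of_real (e i)) [0..<n]. [:- a, 1:])
    = (\<Prod>i\<in>{..<n}. [:- complex_of_real (e i), 1:])"
    by (simp add: o_def prod.distinct_set_conv_list[symmetric] atLeast0LessThan)
  finally have cp: "char_poly A = (\<Prod>i\<in>{..<n}. [:- complex_of_real (e i), 1:])" .
  have ord: "Polynomial.order (complex_of_real x) (char_poly A) = card {i \<in> {..<n}. e i = x}" for x
    unfolding cp by (subst order_prod_linear_factors) auto
  have ev: "eigenvalue A (complex_of_real x) \<longleftrightarrow> x \<in> e ` {..<n}" for x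
    by (auto simp: eigenvalue_root_char_poly[OF Ac] cp poly_prod)
  define T where "T = {x \<in> e ` {..<n}. P x}"
  have "{x. P x \<and> eigenvalue A (complex_of_real x)} = T" by (auto simp: T_def ev)
  then have "(\<Sum>x | P x \<and> eigenvalue A (complex_of_real x). Polynomial.order (complex_of_real x) (char_poly A))
      = (\<Sum>x\<in>T. card {i \<in> {..<n}. e i = x})"
    by (simp add: ord)
  also have "\<dots> = card (\<Union>x\<in>T. {i \<in> {..<n}. e i = x})"
    by (rule card_UN_disjoint[symmetric]) (auto simp: T_def)
  also have "(\<Union>x\<in>T. {i \<in> {..<n}. e i = x}) = {i. i < n \<and> P (e i)}"
    by (auto simp: T_def)
  finally show ?thesis .
qed

text \<open>Fewer than \<open>n\<close> homogeneous equations in \<open>n\<close> unknowns have a nontrivial solution: padded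
with zero rows to a square matrix, the system has determinant zero.\<close>

lemma exists_nonzero_orthogonal_to_few:
  fixes rs :: "complex vec list"
  assumes rs: "set rs \<subseteq> carrier_vec n" and len: "length rs < n"
  shows "\<exists>x \<in> carrier_vec n. x \<noteq> 0\<^sub>v n \<and> (\<forall>r \<in> set rs. r \<bullet> x = 0)"
proof -
  define rs' where "rs' = rs @ replicate (n - length rs) (0\<^sub>v n)"
  define R where "R = mat_of_rows n rs'"
  have len': "length rs' = n" using len by (simp add: rs'_def)
  have rs'c: "rs' ! i \<in> carrier_vec n" if "i < n" for i
    using that rs len' unfolding rs'_def by (auto simp: nth_append dest: nth_mem)
  have R: "R \<in> carrier_mat n n" using len' by (auto simp: R_def)
  have Rt: "transpose_mat R \<in> carrier_mat n n" using R by simp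
  have row: "row R i = rs' ! i" if "i < n" for i
    using that rs'c len' by (simp add: R_def)
  have "\<not> n - 1 < length rs" "n - 1 - length rs < n - length rs" using len by linarith+
  then have last: "rs' ! (n - 1) = 0\<^sub>v n" by (simp add: rs'_def nth_append)
  have "transpose_mat R *\<^sub>v unit_vec n (n - 1) = 0\<^sub>v n"
  proof (rule eq_vecI)
    fix i assume "i < dim_vec (0\<^sub>v n :: complex vec)"
    then have i: "i < n" by simp
    have "(transpose_mat R *\<^sub>v unit_vec n (n - 1)) $ i = row R (n - 1) $ i"
      using i len R by simp
    then show "(transpose_mat R *\<^sub>v unit_vec n (n - 1)) $ i = 0\<^sub>v n $ i"
      using i len by (simp add: row last[unfolded One_nat_def])
  qed (use R in simp)
  moreover have "unit_vec n (n - 1) \<noteq> (0\<^sub>v n :: complex vec)" using len by simp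
  ultimately have "det (transpose_mat R) = 0"
    using det_0_iff_vec_prod_zero_field[OF Rt] unit_vec_carrier by blast
  then have "det R = 0" using det_transpose[OF R] by simp
  then obtain x where x: "x \<in> carrier_vec n" "x \<noteq> 0\<^sub>v n" "R *\<^sub>v x = 0\<^sub>v n"
    using det_0_iff_vec_prod_zero_field[OF R] by blast
  have "r \<bullet> x = 0" if r: "r \<in> set rs" for r
  proof -
    obtain i where i: "i < length rs" "rs ! i = r" using r by (auto simp: in_set_conv_nth)
    then have "row R i = r" using row[of i] len by (simp add: rs'_def nth_append)
    then have "r \<bullet> x = (R *\<^sub>v x) $ i" using i len R by simp
    then show ?thesis using x(3) i len by simp
  qed
  then show ?thesis using x by blast
qed

text \<open>If \<open>d\<close> had more positive entries than \<open>d'\<close>, the conditions that the coordinates of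
\<open>Yx\<close> vanish where \<open>d\<close> is not positive and those of \<open>Zx\<close> vanish where \<open>d'\<close> is positive would
be fewer than \<open>n\<close> equations. A nonzero solution \<open>x\<close> makes the left sum positive and the right sum
nonpositive.\<close>

lemma card_positive_le_of_quad_eq:
  fixes Y Z :: "complex mat"
  assumes Y: "Y \<in> carrier_mat n n" and Z: "Z \<in> carrier_mat n n" and det: "det Y \<noteq> 0"
    and eq: "\<And>x. x \<in> carrier_vec n \<Longrightarrow>
      (\<Sum>i<n. d i * (cmod ((Y *\<^sub>v x) $ i))\<^sup>2) = (\<Sum>i<n. d' i * (cmod ((Z *\<^sub>v x) $ i))\<^sup>2)"
  shows "card {i. i < n \<and> 0 < d i} \<le> card {i. i < n \<and> 0 < d' i}"
proof (rule ccontr)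
  assume less: "\<not> ?thesis"
  \<comment> \<open>The rows express the vanishing of the unwanted coordinates of \<open>Yx\<close> and \<open>Zx\<close>.\<close>
  define rs where "rs = map (row Y) (filter (\<lambda>i. \<not> 0 < d i) [0..<n]) @ map (row Z) (filter (\<lambda>i. 0 < d' i) [0..<n])"
  have len_filter: "length (filter Q [0..<n]) = card {i. i < n \<and> Q i}" for Q
    by (simp add: distinct_card[symmetric])
  have "{i. i < n \<and> 0 < d i} \<union> {i. i < n \<and> \<not> 0 < d i} = {..<n}" by auto
  then have "card {i. i < n \<and> 0 < d i} + card {i. i < n \<and> \<not> 0 < d i} = n"
    by (subst card_Un_disjoint[symmetric]) auto
  then have "length rs < n" using less by (simp add: rs_def len_filter)
  moreover have "set rs \<subseteq> carrier_vec n" using Y Z by (auto simp: rs_def)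
  ultimately obtain x where x: "x \<in> carrier_vec n" "x \<noteq> 0\<^sub>v n" and orth: "\<And>r. r \<in> set rs \<Longrightarrow> r \<bullet> x = 0"
    using exists_nonzero_orthogonal_to_few by blast
  have Yx: "(Y *\<^sub>v x) $ i = 0" if "i < n" "\<not> 0 < d i" for i
    using orth[of "row Y i"] that Y by (auto simp: rs_def)
  have Zx: "(Z *\<^sub>v x) $ i = 0" if "i < n" "0 < d' i" for i
    using orth[of "row Z i"] that Z by (auto simp: rs_def)
  have "Y *\<^sub>v x \<noteq> 0\<^sub>v n" using det_0_iff_vec_prod_zero_field[OF Y] det x by blast
  then obtain j where j: "j < n" "(Y *\<^sub>v x) $ j \<noteq> 0"
    using Y by (metis carrier_matD(1) dim_mult_mat_vec eq_vecI index_zero_vec)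
  have "0 < (\<Sum>i<n. d i * (cmod ((Y *\<^sub>v x) $ i))\<^sup>2)"
  proof (rule sum_pos2[of _ j])
    show "0 < d j * (cmod ((Y *\<^sub>v x) $ j))\<^sup>2" using j Yx[of j] by (intro mult_pos_pos) auto
    show "0 \<le> d i * (cmod ((Y *\<^sub>v x) $ i))\<^sup>2" if "i \<in> {..<n}" for i
      using Yx[of i] that by (cases "0 < d i") auto
  qed (use j in auto)
  also have "\<dots> = (\<Sum>i<n. d' i * (cmod ((Z *\<^sub>v x) $ i))\<^sup>2)" by (rule eq[OF x(1)])
  also have "\<dots> \<le> 0"
  proof (rule sum_nonpos)
    fix i assume "i \<in> {..<n}"
    then show "d' i * (cmod ((Z *\<^sub>v x) $ i))\<^sup>2 \<le> 0"
      using Zx[of i] by (cases "0 < d' i") (auto simp: mult_nonpos_nonneg)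
  qed
  finally show False by simp
qed

lemma quad_form_diagonal_congruence:
  fixes C :: "complex mat"
  assumes C: "C \<in> carrier_mat n n" and x: "x \<in> carrier_vec n"
  shows "quad_form (mat_adjoint C * real_diag n d * C) x
    = complex_of_real (\<Sum>i<n. d i * (cmod ((C *\<^sub>v x) $ i))\<^sup>2)"
proof -
  have Cx: "C *\<^sub>v x \<in> carrier_vec n" using C x by simp
  have "quad_form (mat_adjoint C * real_diag n d * C) x = quad_form (real_diag n d) (C *\<^sub>v x)"
    using quad_form_congruence[of "real_diag n d" n "mat_adjoint C" n x] C x by auto
  also have "\<dots> = (\<Sum>i<n. complex_of_real (d i) * (C *\<^sub>v x) $ i * cnj ((C *\<^sub>v x) $ i))"
  proof -
    have "real_diag n d *\<^sub>v (C *\<^sub>v x) = vec n (\<lambda>i. complex_of_real (d i) * (C *\<^sub>v x) $ i)"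
    proof (rule eq_vecI)
      fix i assume "i < dim_vec (vec n (\<lambda>i. complex_of_real (d i) * (C *\<^sub>v x) $ i))"
      then have i: "i < n" by simp
      have "(real_diag n d *\<^sub>v (C *\<^sub>v x)) $ i
        = (\<Sum>j<n. (if i = j then complex_of_real (d j) else 0) * (C *\<^sub>v x) $ j)"
        using i C x by (simp add: mat_diag_def scalar_prod_def atLeast0LessThan)
      also have "\<dots> = (\<Sum>j<n. if i = j then complex_of_real (d j) * (C *\<^sub>v x) $ j else 0)"
        by (rule sum.cong) auto
      finally show "(real_diag n d *\<^sub>v (C *\<^sub>v x)) $ i = vec n (\<lambda>i. complex_of_real (d i) * (C *\<^sub>v x) $ i) $ i"
        using i by simp
    qed (simp add: mat_diag_def)
    then show ?thesis using Cx C unfolding quad_form_def by (simp add: cscalar_sum[of _ n])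
  qed
  finally show ?thesis
    by (simp add: complex_norm_square mult.assoc del: of_real_power)
qed

text \<open>Comparing an arbitrary diagonal congruence of \<open>A\<close> with the unitary diagonalization,
whose diagonal consists of the eigenvalues, gives Sylvester's law for the eigenvalue counts. The
negative count follows by negating both diagonals.\<close>

theorem sylvester_inertia:
  fixes C :: "complex mat"
  assumes C: "C \<in> carrier_mat n n" and det: "det C \<noteq> 0"
    and A: "A = mat_adjoint C * real_diag n d * C"
  shows "i_plus A = card {i. i < n \<and> 0 < d i}" "i_minus A = card {i. i < n \<and> d i < 0}"
proof -
  have "real_diag n d \<in> hermitian_mats n" by (simp add: hermitian_mats_def)
  from hermitian_congruence[OF this adjoint_carrier[OF C]]
  have "A \<in> hermitian_mats n" by (simp add: A)
  then obtain U e where U: "U \<in> carrier_mat n n" and UU: "mat_adjoint U * U = 1\<^sub>m n"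
    and A_eq: "A = U * real_diag n e * mat_adjoint U"
    using hermitian_unitary_diagonalization by blast
  note U' = adjoint_carrier[OF U]
  have "det (mat_adjoint U) * det U = 1" using det_mult[OF U' U] UU by simp
  then have det': "det (mat_adjoint U) \<noteq> 0" by auto
  have "complex_of_real (\<Sum>i<n. d i * (cmod ((C *\<^sub>v x) $ i))\<^sup>2)
      = complex_of_real (\<Sum>i<n. e i * (cmod ((mat_adjoint U *\<^sub>v x) $ i))\<^sup>2)"
    if "x \<in> carrier_vec n" for x
    using quad_form_diagonal_congruence[OF C that, of d] quad_form_diagonal_congruence[OF U' that, of e]
    by (simp add: A[symmetric] A_eq[symmetric] del: of_real_sum of_real_mult)
  then have eq: "(\<Sum>i<n. d i * (cmod ((C *\<^sub>v x) $ i))\<^sup>2)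
      = (\<Sum>i<n. e i * (cmod ((mat_adjoint U *\<^sub>v x) $ i))\<^sup>2)" if "x \<in> carrier_vec n" for x
    using that by (simp only: of_real_eq_iff)
  then have eq': "(\<Sum>i<n. - d i * (cmod ((C *\<^sub>v x) $ i))\<^sup>2)
      = (\<Sum>i<n. - e i * (cmod ((mat_adjoint U *\<^sub>v x) $ i))\<^sup>2)" if "x \<in> carrier_vec n" for x
    using that by (simp add: sum_negf)
  have "card {i. i < n \<and> 0 < d i} = card {i. i < n \<and> 0 < e i}"
    using card_positive_le_of_quad_eq[OF C U' det, of d e] card_positive_le_of_quad_eq[OF U' C det', of e d] eq by force
  then show "i_plus A = card {i. i < n \<and> 0 < d i}"
    unfolding i_plus_def using sum_order_char_poly_diagonalized[OF U UU A_eq, of "\<lambda>x. 0 < x"] by simp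
  have "card {i. i < n \<and> 0 < - d i} = card {i. i < n \<and> 0 < - e i}"
    using card_positive_le_of_quad_eq[OF C U' det, of "\<lambda>i. - d i" "\<lambda>i. - e i"]
      card_positive_le_of_quad_eq[OF U' C det', of "\<lambda>i. - e i" "\<lambda>i. - d i"] eq' by force
  then show "i_minus A = card {i. i < n \<and> d i < 0}"
    unfolding i_minus_def using sum_order_char_poly_diagonalized[OF U UU A_eq, of "\<lambda>x. x < 0"] by simp
qed

text \<open>The matrix \<open>M\<close> is congruent to the direct sum of \<open>P\<close> and \<open>N\<close> under the unipotent
matrix with rows \<open>[I, 0]\<close> and \<open>[T, I]\<close>, that is, \<open>P\<close> is a generalized Schur complement of
\<open>N\<close> in \<open>M\<close>. Diagonalizing \<open>P\<close> and \<open>N\<close> separately therefore diagonalizes \<open>M\<close> by a congruence.\<close>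

lemma i_plus_minus_block_congruence:
  fixes T :: "complex mat"
  assumes P: "P \<in> hermitian_mats m" and N: "N \<in> hermitian_mats k" and T: "T \<in> carrier_mat k m"
  defines "M \<equiv> four_block_mat (P + mat_adjoint T * N * T) (mat_adjoint T * N) (N * T) N"
  shows "i_plus M = i_plus P + i_plus N" "i_minus M = i_minus P + i_minus N"
proof -
  note T' = adjoint_carrier[OF T]
  obtain U d where U: "U \<in> carrier_mat m m" and UU: "mat_adjoint U * U = 1\<^sub>m m"
    and P_eq: "P = U * real_diag m d * mat_adjoint U"
    using hermitian_unitary_diagonalization[OF P] by blast
  obtain V e where V: "V \<in> carrier_mat k k" and VV: "mat_adjoint V * V = 1\<^sub>m k"
    and N_eq: "N = V * real_diag k e * mat_adjoint V"
    using hermitian_unitary_diagonalization[OF N] by blast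
  note U' = adjoint_carrier[OF U] and V' = adjoint_carrier[OF V]
  note Pc = hermitian_carrier[OF P] and Nc = hermitian_carrier[OF N]
  have "det (mat_adjoint U) * det U = 1" "det (mat_adjoint V) * det V = 1"
    using det_mult[OF U' U] UU det_mult[OF V' V] VV by simp_all
  then have det: "det (mat_adjoint U) \<noteq> 0" "det (mat_adjoint V) \<noteq> 0" by auto
  define C where "C = four_block_mat (mat_adjoint U) (0\<^sub>m m k) (mat_adjoint V * T) (mat_adjoint V)"
  have VT: "mat_adjoint V * T \<in> carrier_mat k m" using V' T by simp
  have C: "C \<in> carrier_mat (m + k) (m + k)" using U' V' by (simp add: C_def)
  have detC: "det C \<noteq> 0"
    using det_four_block_mat_upper_right_zero[OF U' refl VT V'] det by (simp add: C_def)
  \<comment> \<open>The diagonals of \<open>P\<close> and \<open>N\<close>, one after the other.\<close>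
  define f where "f = (\<lambda>i. if i < m then d i else e (i - m))"
  have D: "real_diag (m + k) f = four_block_mat (real_diag m d) (0\<^sub>m m k) (0\<^sub>m k m) (real_diag k e)"
    by (rule eq_matI) (auto simp: mat_diag_def f_def)
  have C': "mat_adjoint C = four_block_mat U (mat_adjoint T * V) (0\<^sub>m k m) V"
    using adjoint_four_block[OF U' zero_carrier_mat VT V'] adjoint_mult[OF V' T] by (simp add: C_def)
  have Dd: "real_diag m d \<in> carrier_mat m m" and De: "real_diag k e \<in> carrier_mat k k" by simp_all
  have TV: "mat_adjoint T * V \<in> carrier_mat m k" using T' V by simp
  have "mat_adjoint C * real_diag (m + k) f
      = four_block_mat (U * real_diag m d) (mat_adjoint T * V * real_diag k e) (0\<^sub>m k m) (V * real_diag k e)"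
    unfolding C' D
    using mult_four_block_mat[OF U TV zero_carrier_mat V Dd zero_carrier_mat zero_carrier_mat De] U TV V T
    by (simp add: mult_carrier_mat[of _ _ k _ k] mult_carrier_mat[of _ m m _ m]
        left_mult_zero_mat[OF Dd] left_mult_zero_mat[OF De])
  moreover have "four_block_mat (U * real_diag m d) (mat_adjoint T * V * real_diag k e) (0\<^sub>m k m) (V * real_diag k e) * C
      = four_block_mat (U * real_diag m d * mat_adjoint U + mat_adjoint T * V * real_diag k e * (mat_adjoint V * T))
          (mat_adjoint T * V * real_diag k e * mat_adjoint V)
          (V * real_diag k e * (mat_adjoint V * T)) (V * real_diag k e * mat_adjoint V)"
  proof -
    have c: "U * real_diag m d \<in> carrier_mat m m" "mat_adjoint T * V * real_diag k e \<in> carrier_mat m k"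
      "V * real_diag k e \<in> carrier_mat k k" using U V TV by auto
    show ?thesis
      unfolding C_def mult_four_block_mat[OF c(1,2) zero_carrier_mat c(3) U' zero_carrier_mat VT V']
      using c U' V' VT T
      by (simp add: mult_carrier_mat[of _ m k _ k] mult_carrier_mat[of _ k k _ k]
          mult_carrier_mat[of _ k k _ m] left_mult_zero_mat[OF U'] right_mult_zero_mat[of _ m m])
  qed
  moreover have "mat_adjoint T * V * real_diag k e * mat_adjoint V = mat_adjoint T * N"
    unfolding N_eq using T' V V' De
    by (simp add: assoc_mult_mat[of _ m k _ k _ k] assoc_mult_mat[of _ k k _ k _ k] mult_carrier_mat[of _ k k _ k])
  moreover have "V * real_diag k e * (mat_adjoint V * T) = N * T"
    unfolding N_eq using T V V' De
    by (simp add: assoc_mult_mat[of _ k k _ k _ m] mult_carrier_mat[of _ k k _ k])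
  moreover have "mat_adjoint T * V * real_diag k e * (mat_adjoint V * T) = mat_adjoint T * N * T"
    unfolding N_eq using T T' V V' De
    by (simp add: assoc_mult_mat[of _ m k _ k _ m] assoc_mult_mat[of _ m k _ k _ k]
        assoc_mult_mat[of _ k k _ k _ m] assoc_mult_mat[of _ k k _ k _ k] mult_carrier_mat[of _ k k _ k]
        mult_carrier_mat[of _ k k _ m])
  ultimately have M: "M = mat_adjoint C * real_diag (m + k) f * C"
    by (simp add: M_def flip: P_eq N_eq)
  have split: "card {i. i < m + k \<and> Q (f i)} = card {i. i < m \<and> Q (d i)} + card {i. i < k \<and> Q (e i)}" for Q
  proof -
    have "{i. i < m + k \<and> Q (f i)} = {i. i < m \<and> Q (d i)} \<union> (\<lambda>i. m + i) ` {i. i < k \<and> Q (e i)}"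
      (is "?L = ?R")
    proof (rule Set.set_eqI)
      fix i show "i \<in> ?L \<longleftrightarrow> i \<in> ?R"
        by (cases "i < m") (auto simp: f_def image_iff intro: exI[of _ "i - m"])
    qed
    also have "card \<dots> = card {i. i < m \<and> Q (d i)} + card ((\<lambda>i. m + i) ` {i. i < k \<and> Q (e i)})"
      by (rule card_Un_disjoint) auto
    finally show ?thesis by (simp add: card_image)
  qed
  have P_eq': "P = mat_adjoint (mat_adjoint U) * real_diag m d * mat_adjoint U"
    and N_eq': "N = mat_adjoint (mat_adjoint V) * real_diag k e * mat_adjoint V"
    by (simp_all flip: P_eq N_eq)
  show "i_plus M = i_plus P + i_plus N" "i_minus M = i_minus P + i_minus N"
    unfolding sylvester_inertia[OF C detC M] sylvester_inertia[OF U' det(1) P_eq']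
      sylvester_inertia[OF V' det(2) N_eq'] by (rule split)+
qed

section \<open>The bordered matrix\<close>

lemma mem_mat_range_iff:
  fixes A :: "complex mat"
  assumes "A \<in> carrier_mat m n"
  shows "y \<in> mat_range A \<longleftrightarrow> (\<exists>x \<in> carrier_vec n. A *\<^sub>v x = y)"
proof -
  interpret vec_space "TYPE(complex)" m .
  have "mat_range A = {y \<in> carrier_vec m. \<exists>x \<in> carrier_vec n. A *\<^sub>v x = y}"
    using col_space_eq[of A n] assms by simp
  then show ?thesis using assms by auto
qed

lemma zero_append_rows_mult_vec:
  fixes C :: "complex mat"
  assumes "C \<in> carrier_mat n k" "w \<in> carrier_vec k"
  shows "(0\<^sub>m m k @\<^sub>r C) *\<^sub>v w = 0\<^sub>v m @\<^sub>v (C *\<^sub>v w)"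
proof -
  have "0\<^sub>m m k *\<^sub>v w = 0\<^sub>v m"
    using assms by (intro eq_vecI) (auto simp: scalar_prod_def)
  then show ?thesis
    using assms by (simp add: mat_mult_append[of _ m k _ n])
qed

text \<open>For \<open>G\<close> of size \<open>m + n\<close>, the lower right block of size \<open>n\<close>.\<close>

definition corner :: "nat \<Rightarrow> nat \<Rightarrow> complex mat \<Rightarrow> complex mat" where
  "corner m n G = (0\<^sub>m n m @\<^sub>c 1\<^sub>m n) * G * (0\<^sub>m m n @\<^sub>r 1\<^sub>m n)"

lemma corner_conv_congruence:
  "corner m n G = mat_adjoint (0\<^sub>m m n @\<^sub>r 1\<^sub>m n) * G * (0\<^sub>m m n @\<^sub>r 1\<^sub>m n)"
  using adjoint_zero_append_rows[of m "1\<^sub>m n"] by (simp add: corner_def)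

lemma corner_hermitian:
  assumes "G \<in> hermitian_mats (m + n)"
  shows "corner m n G \<in> hermitian_mats n"
  using hermitian_congruence[OF assms, of "mat_adjoint (0\<^sub>m m n @\<^sub>r 1\<^sub>m n)" n]
  by (simp add: corner_conv_congruence)

lemma quad_form_corner:
  assumes "G \<in> carrier_mat (m + n) (m + n)" and "c \<in> carrier_vec n"
  shows "quad_form (corner m n G) c = quad_form G (0\<^sub>v m @\<^sub>v c)"
  using quad_form_congruence[OF assms(1) _ assms(2), of "mat_adjoint (0\<^sub>m m n @\<^sub>r 1\<^sub>m n)"] assms(2)
  by (simp add: corner_conv_congruence zero_append_rows_mult_vec[of _ n n])

lemma mult_pinv_of_mem_range:
  assumes N: "N \<in> hermitian_mats k" and w: "w \<in> mat_range N"
  shows "N *\<^sub>v (pinv N *\<^sub>v w) = w"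
proof -
  note Nc = hermitian_carrier[OF N]
  have Gc: "pinv N \<in> carrier_mat k k" using pinv_hermitian[OF N] by (rule hermitian_carrier)
  obtain u where u: "u \<in> carrier_vec k" "N *\<^sub>v u = w" using w mem_mat_range_iff[OF Nc] by blast
  have "N * pinv N * N *\<^sub>v u = N *\<^sub>v (pinv N *\<^sub>v (N *\<^sub>v u))"
    using Nc Gc u(1) by (simp add: assoc_mult_mat_vec[of _ k k _ k] mult_carrier_mat[of _ k k _ k])
  then show ?thesis using is_pinv_pinv_hermitian[OF N] by (simp add: is_pinv_def u(2))
qed

context
  fixes A B :: "complex mat" and m n :: nat
  assumes A: "A \<in> hermitian_mats m" and B: "B \<in> carrier_mat m n"
begin

lemma bordered_hermitian: "bordered_mat A B \<in> hermitian_mats (m + n)"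
proof -
  have "mat_adjoint (- A) = - A"
    by (simp add: adjoint_uminus hermitian_adjoint[OF A])
  then show ?thesis
    using hermitian_carrier[OF A] B
    by (auto simp: hermitian_mats_def bordered_mat_def adjoint_four_block[of _ m m _ n _ n])
qed

lemma bordered_mult_vec:
  assumes y: "y \<in> carrier_vec m" and z: "z \<in> carrier_vec n"
  shows "bordered_mat A B *\<^sub>v (y @\<^sub>v z) = (B *\<^sub>v z - A *\<^sub>v y) @\<^sub>v (mat_adjoint B *\<^sub>v y)"
proof -
  note Ac = hermitian_carrier[OF A]
  have "bordered_mat A B *\<^sub>v (y @\<^sub>v z)
    = (- A *\<^sub>v y + B *\<^sub>v z) @\<^sub>v (mat_adjoint B *\<^sub>v y + 0\<^sub>m n n *\<^sub>v z)"
    unfolding bordered_mat_def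
    using B Ac y z by (simp add: four_block_mat_mult_vec[of _ m m _ n _ n])
  moreover have "- A *\<^sub>v y + B *\<^sub>v z = B *\<^sub>v z - A *\<^sub>v y"
    using Ac B y z by (intro eq_vecI) auto
  moreover have "mat_adjoint B *\<^sub>v y + 0\<^sub>m n n *\<^sub>v z = mat_adjoint B *\<^sub>v y"
    using B y z by (intro eq_vecI) (auto simp: scalar_prod_def)
  ultimately show ?thesis by simp
qed

lemma bordered_mult_vec_eq_iff:
  assumes y: "y \<in> carrier_vec m" and z: "z \<in> carrier_vec n" and c: "c \<in> carrier_vec n"
  shows "bordered_mat A B *\<^sub>v (y @\<^sub>v z) = 0\<^sub>v m @\<^sub>v c \<longleftrightarrow> A *\<^sub>v y = B *\<^sub>v z \<and> mat_adjoint B *\<^sub>v y = c"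
proof -
  note Ac = hermitian_carrier[OF A]
  have car: "B *\<^sub>v z - A *\<^sub>v y \<in> carrier_vec m" "mat_adjoint B *\<^sub>v y \<in> carrier_vec n"
    using Ac B y z mult_mat_vec_carrier[OF adjoint_carrier[OF B] y] by auto
  have "B *\<^sub>v z - A *\<^sub>v y = 0\<^sub>v m \<longleftrightarrow> A *\<^sub>v y = B *\<^sub>v z"
  proof
    assume eq: "B *\<^sub>v z - A *\<^sub>v y = 0\<^sub>v m"
    show "A *\<^sub>v y = B *\<^sub>v z"
    proof (rule eq_vecI)
      fix i assume "i < dim_vec (B *\<^sub>v z)"
      then show "(A *\<^sub>v y) $ i = (B *\<^sub>v z) $ i"
        using arg_cong[OF eq, of "\<lambda>u. u $ i"] Ac B by simp
    qed (use Ac B in simp)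
  next
    assume "A *\<^sub>v y = B *\<^sub>v z"
    moreover have "B *\<^sub>v z \<in> carrier_vec m" using B z by simp
    ultimately show "B *\<^sub>v z - A *\<^sub>v y = 0\<^sub>v m" by simp
  qed
  then show ?thesis
    unfolding bordered_mult_vec[OF y z]
    using append_vec_eq[OF car(1) zero_carrier_vec, of "mat_adjoint B *\<^sub>v y" c] by simp
qed

lemma mem_range_bordered_iff:
  assumes c: "c \<in> carrier_vec n"
  shows "0\<^sub>v m @\<^sub>v c \<in> mat_range (bordered_mat A B)
    \<longleftrightarrow> (\<exists>y \<in> carrier_vec m. \<exists>z \<in> carrier_vec n. A *\<^sub>v y = B *\<^sub>v z \<and> mat_adjoint B *\<^sub>v y = c)"
proof -
  note N = hermitian_carrier[OF bordered_hermitian]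
  have "0\<^sub>v m @\<^sub>v c \<in> mat_range (bordered_mat A B)
    \<longleftrightarrow> (\<exists>x \<in> carrier_vec (m + n). bordered_mat A B *\<^sub>v x = 0\<^sub>v m @\<^sub>v c)"
    by (rule mem_mat_range_iff[OF N])
  also have "\<dots> \<longleftrightarrow> (\<exists>y \<in> carrier_vec m. \<exists>z \<in> carrier_vec n. bordered_mat A B *\<^sub>v (y @\<^sub>v z) = 0\<^sub>v m @\<^sub>v c)"
    using all_vec_append[of m n "\<lambda>x. bordered_mat A B *\<^sub>v x \<noteq> 0\<^sub>v m @\<^sub>v c"] by blast
  finally show ?thesis using bordered_mult_vec_eq_iff[OF _ _ c] by blast
qed

text \<open>The value of the candidate at \<open>c\<close> is computed by solving the bordered system with right hand
side \<open>(0, c)\<close>. The solution \<open>(y, z)\<close> supplied by the pseudoinverse gives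
$c^{*}X_0c = z^{*}c = z^{*}B^{*}y = (Bz)^{*}y = (Ay)^{*}y$.\<close>

lemma quad_form_corner_pinv:
  assumes c: "c \<in> carrier_vec n" and range: "0\<^sub>v m @\<^sub>v c \<in> mat_range (bordered_mat A B)"
  obtains y z where "y \<in> carrier_vec m" "z \<in> carrier_vec n"
    "A *\<^sub>v y = B *\<^sub>v z" "mat_adjoint B *\<^sub>v y = c"
    "quad_form (corner m n (pinv (bordered_mat A B))) c = quad_form A y"
proof -
  let ?N = "bordered_mat A B"
  note N = bordered_hermitian
  note G = pinv_hermitian[OF N]
  have w: "0\<^sub>v m @\<^sub>v c \<in> carrier_vec (m + n)" using c by simp
  define x where "x = pinv ?N *\<^sub>v (0\<^sub>v m @\<^sub>v c)"
  have x: "x \<in> carrier_vec (m + n)" unfolding x_def using hermitian_carrier[OF G] w by simp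
  have Nx: "?N *\<^sub>v x = 0\<^sub>v m @\<^sub>v c"
    unfolding x_def by (rule mult_pinv_of_mem_range[OF N range])
  define y z where "y = vec_first x m" and "z = vec_last x n"
  have y: "y \<in> carrier_vec m" and z: "z \<in> carrier_vec n" and x_eq: "x = y @\<^sub>v z"
    using x by (simp_all add: y_def z_def)
  have Ay: "A *\<^sub>v y = B *\<^sub>v z" and By: "mat_adjoint B *\<^sub>v y = c"
    using Nx bordered_mult_vec_eq_iff[OF y z c] by (simp_all add: x_eq)
  have "quad_form (corner m n (pinv ?N)) c = x \<bullet>c (0\<^sub>v m @\<^sub>v c)"
    by (simp add: quad_form_corner[OF hermitian_carrier[OF G] c]) (simp add: quad_form_def x_def)
  also have "\<dots> = z \<bullet>c (mat_adjoint B *\<^sub>v y)"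
    using y z c by (simp add: x_eq By cscalar_append[of _ m _ _ n])
  also have "\<dots> = quad_form A y"
    using cscalar_adjoint[OF B z y] by (simp add: quad_form_def Ay)
  finally show ?thesis using that[OF y z Ay By] by simp
qed

lemma feasible_quad_form_le:
  assumes X: "X \<in> hermitian_mats n" and le: "B * X * mat_adjoint B \<preceq>\<^sub>L A" and v: "v \<in> carrier_vec m"
  shows "quad_form X (mat_adjoint B *\<^sub>v v) \<le> quad_form A v"
  using le v loewner_le_iff_quad_form[OF hermitian_congruence[OF X B] A]
    quad_form_congruence[OF hermitian_carrier[OF X] B v]
  by auto

text \<open>For \<open>c = B\<^sup>*y\<close> feasibility of \<open>X\<close> bounds its form at \<open>c\<close> by $y^{*}Ay$, and
for the \<open>y\<close> that solves the bordered system the candidate attains this bound.\<close>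

lemma feasible_le_corner_pinv:
  assumes X: "X \<in> hermitian_mats n" and le: "B * X * mat_adjoint B \<preceq>\<^sub>L A"
    and c: "c \<in> carrier_vec n" and range: "0\<^sub>v m @\<^sub>v c \<in> mat_range (bordered_mat A B)"
  shows "quad_form X c \<le> quad_form (corner m n (pinv (bordered_mat A B))) c"
  using feasible_quad_form_le[OF X le] quad_form_corner_pinv[OF c range] by metis

text \<open>This is where solvability of the constraint enters. From the two equations $a^{*}Aa = a^{*}Bb = 0$,
and since $B^{*}a = 0$ the positive semidefinite matrix $A - BXB^{*}$ also has value zero at \<open>a\<close>.
It therefore annihilates \<open>a\<close>, and so does \<open>A\<close>.\<close>

lemma bordered_kernel_of_feasible:
  assumes X: "X \<in> hermitian_mats n" and le: "B * X * mat_adjoint B \<preceq>\<^sub>L A"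
    and a: "a \<in> carrier_vec m" and b: "b \<in> carrier_vec n"
    and Aa: "A *\<^sub>v a = B *\<^sub>v b" and Ba: "mat_adjoint B *\<^sub>v a = 0\<^sub>v n"
  shows "A *\<^sub>v a = 0\<^sub>v m"
proof -
  note Xc = hermitian_carrier[OF X] and Ac = hermitian_carrier[OF A]
  note BXB = hermitian_congruence[OF X B]
  define H where "H = A - B * X * mat_adjoint B"
  have H: "H \<in> hermitian_mats m" unfolding H_def by (rule hermitian_minus[OF A BXB])
  have qH: "quad_form H v = quad_form A v - quad_form X (mat_adjoint B *\<^sub>v v)" if "v \<in> carrier_vec m" for v
    using quad_form_minus_mat[OF Ac hermitian_carrier[OF BXB] that] quad_form_congruence[OF Xc B that]
    by (simp add: H_def)
  have "quad_form A a = b \<bullet>c (mat_adjoint B *\<^sub>v a)"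
    using cscalar_adjoint[OF B b a] by (simp add: quad_form_def Aa)
  then have "quad_form A a = 0" using b by (simp add: Ba)
  moreover have "X *\<^sub>v 0\<^sub>v n = 0\<^sub>v n" using Xc by (intro eq_vecI) (auto simp: scalar_prod_def)
  ultimately have "quad_form H a = 0" using qH[OF a] by (simp add: Ba quad_form_def)
  moreover have "0 \<le> quad_form H v" if "v \<in> carrier_vec m" for v
    using qH[OF that] feasible_quad_form_le[OF X le that] by simp
  ultimately have "H *\<^sub>v a = 0\<^sub>v m" using psd_quad_form_zero_imp_kernel[OF H _ a] by blast
  moreover have "B * X * mat_adjoint B *\<^sub>v a = 0\<^sub>v m"
  proof -
    have "B * X * mat_adjoint B *\<^sub>v a = B * X *\<^sub>v (mat_adjoint B *\<^sub>v a)"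
      using B Xc a by (intro assoc_mult_mat_vec[of _ m n _ m]) auto
    also have "\<dots> = 0\<^sub>v m"
      unfolding Ba using B Xc by (intro eq_vecI) (auto simp: scalar_prod_def)
    finally show ?thesis .
  qed
  moreover have "H *\<^sub>v a = A *\<^sub>v a - B * X * mat_adjoint B *\<^sub>v a"
    unfolding H_def by (rule minus_mult_distrib_mat_vec[OF Ac hermitian_carrier[OF BXB] a])
  ultimately show ?thesis using Ac a by simp
qed

text \<open>By the preceding lemma a kernel vector \<open>(a, b)\<close> of the bordered matrix satisfies \<open>Bb = 0\<close>,
so being orthogonal to the kernel only constrains the second component.\<close>

lemma mem_range_bordered_iff_orth_kernel:
  assumes X: "X \<in> hermitian_mats n" and le: "B * X * mat_adjoint B \<preceq>\<^sub>L A" and c: "c \<in> carrier_vec n"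
  shows "0\<^sub>v m @\<^sub>v c \<in> mat_range (bordered_mat A B)
    \<longleftrightarrow> (\<forall>b \<in> carrier_vec n. B *\<^sub>v b = 0\<^sub>v m \<longrightarrow> c \<bullet>c b = 0)"
    (is "?range \<longleftrightarrow> ?orth")
proof
  assume ?range
  then obtain y where y: "y \<in> carrier_vec m" "mat_adjoint B *\<^sub>v y = c"
    using mem_range_bordered_iff[OF c] by blast
  show ?orth
  proof (intro ballI impI)
    fix b assume b: "b \<in> carrier_vec n" and "B *\<^sub>v b = 0\<^sub>v m"
    then have "c \<bullet>c b = y \<bullet>c 0\<^sub>v m"
      using cscalar_adjoint[OF adjoint_carrier[OF B] y(1) b] by (simp add: y(2))
    then show "c \<bullet>c b = 0" using y by simp
  qed
next
  assume orth: ?orth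
  note N = bordered_hermitian
  have w: "0\<^sub>v m @\<^sub>v c \<in> carrier_vec (m + n)" using c by simp
  have "(0\<^sub>v m @\<^sub>v c) \<bullet>c u = 0"
    if u: "u \<in> carrier_vec (m + n)" and ker: "bordered_mat A B *\<^sub>v u = 0\<^sub>v (m + n)" for u
  proof -
    define a b where "a = vec_first u m" and "b = vec_last u n"
    have a: "a \<in> carrier_vec m" and b: "b \<in> carrier_vec n" and u_eq: "u = a @\<^sub>v b"
      using u by (simp_all add: a_def b_def)
    have "0\<^sub>v (m + n) = 0\<^sub>v m @\<^sub>v (0\<^sub>v n :: complex vec)" by (intro eq_vecI) auto
    then have "A *\<^sub>v a = B *\<^sub>v b" "mat_adjoint B *\<^sub>v a = 0\<^sub>v n"
      using ker bordered_mult_vec_eq_iff[OF a b zero_carrier_vec] by (simp_all add: u_eq)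
    then have "B *\<^sub>v b = 0\<^sub>v m" using bordered_kernel_of_feasible[OF X le a b] by simp
    then have "c \<bullet>c b = 0" using orth b by blast
    then show ?thesis using a b c by (simp add: u_eq cscalar_append[of _ m _ _ n])
  qed
  then have "bordered_mat A B *\<^sub>v (pinv (bordered_mat A B) *\<^sub>v (0\<^sub>v m @\<^sub>v c)) = 0\<^sub>v m @\<^sub>v c"
    by (rule mult_pinv_of_orth_kernel[OF N w])
  moreover have "pinv (bordered_mat A B) *\<^sub>v (0\<^sub>v m @\<^sub>v c) \<in> carrier_vec (m + n)"
    using hermitian_carrier[OF pinv_hermitian[OF N]] w by simp
  ultimately show ?range using mem_mat_range_iff[OF hermitian_carrier[OF N]] by blast
qed

text \<open>For \<open>c = B\<^sup>*v\<close> the bordered system is solvable, and its solution \<open>y\<close> differs from \<open>v\<close> by some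
\<open>k\<close> with \<open>B\<^sup>*k = 0\<close>. As \<open>Ay\<close> is in the range of \<open>B\<close>, the cross terms vanish and
$v^{*}Av = y^{*}Ay + k^{*}Ak$, where the last summand is nonnegative by feasibility.\<close>

lemma corner_pinv_feasible:
  assumes X: "X \<in> hermitian_mats n" and le: "B * X * mat_adjoint B \<preceq>\<^sub>L A"
  defines "X0 \<equiv> corner m n (pinv (bordered_mat A B))"
  shows "B * X0 * mat_adjoint B \<preceq>\<^sub>L A"
proof -
  note Ac = hermitian_carrier[OF A] and B' = adjoint_carrier[OF B]
  have X0: "X0 \<in> hermitian_mats n"
    unfolding X0_def by (rule corner_hermitian[OF pinv_hermitian[OF bordered_hermitian]])
  have "quad_form X0 (mat_adjoint B *\<^sub>v v) \<le> quad_form A v" if v: "v \<in> carrier_vec m" for v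
  proof -
    have c: "mat_adjoint B *\<^sub>v v \<in> carrier_vec n" using B' v by simp
    have "(mat_adjoint B *\<^sub>v v) \<bullet>c b = 0" if "b \<in> carrier_vec n" "B *\<^sub>v b = 0\<^sub>v m" for b
      using cscalar_adjoint[OF B' v that(1)] that(2) v by simp
    then have "0\<^sub>v m @\<^sub>v (mat_adjoint B *\<^sub>v v) \<in> mat_range (bordered_mat A B)"
      using mem_range_bordered_iff_orth_kernel[OF X le c] by blast
    then obtain y z where y: "y \<in> carrier_vec m" and z: "z \<in> carrier_vec n"
      and Ay: "A *\<^sub>v y = B *\<^sub>v z" and By: "mat_adjoint B *\<^sub>v y = mat_adjoint B *\<^sub>v v"
      and q: "quad_form X0 (mat_adjoint B *\<^sub>v v) = quad_form A y"
      unfolding X0_def by (rule quad_form_corner_pinv[OF c])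
    define k where "k = v - y"
    have k: "k \<in> carrier_vec m" using v y by (simp add: k_def)
    have v_eq: "v = y + k" using v y by (intro eq_vecI) (auto simp: k_def)
    have Bk: "mat_adjoint B *\<^sub>v k = 0\<^sub>v n"
      using c by (simp add: k_def mult_minus_distrib_mat_vec[OF B' v y] By)
    have "(A *\<^sub>v y) \<bullet>c k = 0"
      using cscalar_adjoint[OF B z k] z by (simp add: Ay Bk)
    then have "quad_form A v = quad_form A y + quad_form A k"
      unfolding v_eq using quad_form_add_vec[OF A y k] by simp
    moreover have "0 \<le> quad_form A k"
    proof -
      have "X *\<^sub>v 0\<^sub>v n = 0\<^sub>v n"
        using hermitian_carrier[OF X] by (intro eq_vecI) (auto simp: scalar_prod_def)
      then show ?thesis
        using feasible_quad_form_le[OF X le k] by (simp add: Bk quad_form_def)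
    qed
    ultimately show ?thesis by (simp add: q)
  qed
  then show ?thesis
    using loewner_le_iff_quad_form[OF hermitian_congruence[OF X0 B] A]
      quad_form_congruence[OF hermitian_carrier[OF X0] B] by simp
qed

end

section \<open>Minimization in the Loewner order\<close>

lemma phi_hermitian:
  assumes "A \<in> hermitian_mats m" "B \<in> carrier_mat m n" "X \<in> hermitian_mats n"
  shows "phi A B X \<in> hermitian_mats m"
  using assms by (simp add: phi_def hermitian_minus hermitian_congruence)

lemma phi_le_iff_quad_form:
  assumes A: "A \<in> hermitian_mats m" and B: "B \<in> carrier_mat m n"
    and X: "X \<in> hermitian_mats n" and Y: "Y \<in> hermitian_mats n"
  shows "phi A B X \<preceq>\<^sub>L phi A B Y
    \<longleftrightarrow> (\<forall>v \<in> carrier_vec m. quad_form Y (mat_adjoint B *\<^sub>v v) \<le> quad_form X (mat_adjoint B *\<^sub>v v))"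
proof -
  have "quad_form (phi A B Z) v = quad_form A v - quad_form Z (mat_adjoint B *\<^sub>v v)"
    if "Z \<in> hermitian_mats n" "v \<in> carrier_vec m" for Z v
    using quad_form_minus_mat[OF hermitian_carrier[OF A] hermitian_carrier[OF hermitian_congruence[OF that(1) B]] that(2)]
      quad_form_congruence[OF hermitian_carrier[OF that(1)] B that(2)]
    by (simp add: phi_def)
  then show ?thesis
    using X Y loewner_le_iff_quad_form[OF phi_hermitian[OF A B X] phi_hermitian[OF A B Y]] by simp
qed

definition rank_one :: "complex vec \<Rightarrow> complex mat" where
  "rank_one b = mat (dim_vec b) (dim_vec b) (\<lambda>(i, j). b $ i * cnj (b $ j))"

lemma rank_one_hermitian: "b \<in> carrier_vec n \<Longrightarrow> rank_one b \<in> hermitian_mats n"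
  by (auto simp: rank_one_def hermitian_mats_def intro!: eq_matI)

lemma quad_form_rank_one:
  assumes b: "b \<in> carrier_vec n" and c: "c \<in> carrier_vec n"
  shows "quad_form (rank_one b) c = complex_of_real ((cmod (c \<bullet>c b))\<^sup>2)"
proof -
  have "rank_one b *\<^sub>v c = (c \<bullet>c b) \<cdot>\<^sub>v b"
    using b c by (intro eq_vecI)
      (auto simp: rank_one_def scalar_prod_def sum_distrib_left sum_distrib_right mult_ac)
  then have "quad_form (rank_one b) c = (c \<bullet>c b) * (b \<bullet>c c)"
    using b c by (simp add: quad_form_def)
  also have "b \<bullet>c c = cnj (c \<bullet>c b)" by (rule cscalar_commute[OF b c])
  finally show ?thesis by (simp only: complex_norm_square)
qed

lemma hermitian_add: "H \<in> hermitian_mats n \<Longrightarrow> K \<in> hermitian_mats n \<Longrightarrow> H + K \<in> hermitian_mats n"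
  by (auto simp: hermitian_mats_def adjoint_add)

text \<open>If the range condition failed, some \<open>b\<close> with \<open>B\<^sub>2b = 0\<close> would not be orthogonal to $B_1^{*}w$.
Adding $bb^{*}$ to a minimizer leaves the constraint unchanged, while it increases the form at
$B_1^{*}w$ and thus decreases the objective at \<open>w\<close>.\<close>

lemma range_condition_of_minimizer:
  assumes A1: "A1 \<in> hermitian_mats m1" and A2: "A2 \<in> hermitian_mats m2"
    and B1: "B1 \<in> carrier_mat m1 n" and B2: "B2 \<in> carrier_mat m2 n"
    and X0: "X0 \<in> hermitian_mats n" and le: "B2 * X0 * mat_adjoint B2 \<preceq>\<^sub>L A2"
    and min: "\<And>X. X \<in> hermitian_mats n \<Longrightarrow> B2 * X * mat_adjoint B2 \<preceq>\<^sub>L A2 \<Longrightarrow> phi A1 B1 X0 \<preceq>\<^sub>L phi A1 B1 X"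
    and w: "w \<in> carrier_vec m1"
  shows "0\<^sub>v m2 @\<^sub>v (mat_adjoint B1 *\<^sub>v w) \<in> mat_range (bordered_mat A2 B2)"
proof -
  have c: "mat_adjoint B1 *\<^sub>v w \<in> carrier_vec n"
    by (rule mult_mat_vec_carrier[OF adjoint_carrier[OF B1] w])
  have "(mat_adjoint B1 *\<^sub>v w) \<bullet>c b = 0" if b: "b \<in> carrier_vec n" and B2b: "B2 *\<^sub>v b = 0\<^sub>v m2" for b
  proof -
    \<comment> \<open>Since \<open>B\<^sub>2b = 0\<close>, the perturbation is invisible to the constraint.\<close>
    define X where "X = X0 + rank_one b"
    note R = rank_one_hermitian[OF b]
    have X: "X \<in> hermitian_mats n" unfolding X_def by (rule hermitian_add[OF X0 R])
    have qX: "quad_form X u = quad_form X0 u + complex_of_real ((cmod (u \<bullet>c b))\<^sup>2)" if "u \<in> carrier_vec n" for u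
      using quad_form_add_mat[OF hermitian_carrier[OF X0] hermitian_carrier[OF R] that] quad_form_rank_one[OF b that]
      by (simp add: X_def)
    have "quad_form X (mat_adjoint B2 *\<^sub>v v) \<le> quad_form A2 v" if v: "v \<in> carrier_vec m2" for v
    proof -
      have "(mat_adjoint B2 *\<^sub>v v) \<bullet>c b = 0"
        using cscalar_adjoint[OF adjoint_carrier[OF B2] v b] v by (simp add: B2b)
      then show ?thesis
        using qX[OF mult_mat_vec_carrier[OF adjoint_carrier[OF B2] v]] feasible_quad_form_le[OF A2 B2 X0 le v]
        by simp
    qed
    then have "B2 * X * mat_adjoint B2 \<preceq>\<^sub>L A2"
      using loewner_le_iff_quad_form[OF hermitian_congruence[OF X B2] A2]
        quad_form_congruence[OF hermitian_carrier[OF X] B2] by simp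
    then have "quad_form X (mat_adjoint B1 *\<^sub>v w) \<le> quad_form X0 (mat_adjoint B1 *\<^sub>v w)"
      using min[OF X] phi_le_iff_quad_form[OF A1 B1 X0 X] w by blast
    then show ?thesis
      by (simp add: qX[OF c] less_eq_complex_def)
  qed
  then show ?thesis using mem_range_bordered_iff_orth_kernel[OF A2 B2 X0 le c] by blast
qed

theorem theorem4p2:
  fixes A1 A2 B1 B2 :: "complex mat" and m1 m2 n :: nat
  assumes A1: "A1 \<in> hermitian_mats m1" and A2: "A2 \<in> hermitian_mats m2"
    and B1: "B1 \<in> carrier_mat m1 n" and B2: "B2 \<in> carrier_mat m2 n"
    and feasible: "\<exists>X \<in> hermitian_mats n. B2 * X * mat_adjoint B2 \<preceq>\<^sub>L A2"
  shows
    "((\<exists>X0 \<in> hermitian_mats n.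
          B2 * X0 * mat_adjoint B2 \<preceq>\<^sub>L A2 \<and>
          (\<forall>X \<in> hermitian_mats n. B2 * X * mat_adjoint B2 \<preceq>\<^sub>L A2 \<longrightarrow>
             phi A1 B1 X0 \<preceq>\<^sub>L phi A1 B1 X))
      \<longleftrightarrow> mat_range (0\<^sub>m m2 m1 @\<^sub>r mat_adjoint B1) \<subseteq> mat_range (bordered_mat A2 B2))
     \<and>
     (mat_range (0\<^sub>m m2 m1 @\<^sub>r mat_adjoint B1) \<subseteq> mat_range (bordered_mat A2 B2) \<longrightarrow>
       (let N = bordered_mat A2 B2;
            X0 = (0\<^sub>m n m2 @\<^sub>c 1\<^sub>m n) * pinv N * (0\<^sub>m m2 n @\<^sub>r 1\<^sub>m n);
            P0 = A1 - (0\<^sub>m m1 m2 @\<^sub>c B1) * pinv N * (0\<^sub>m m2 m1 @\<^sub>r mat_adjoint B1);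
            S = {A1 - B1 * X * mat_adjoint B1 | X.
                   B2 * X * mat_adjoint B2 \<preceq>\<^sub>L A2 \<and> X \<in> hermitian_mats n}
        in X0 \<in> hermitian_mats n \<and>
           B2 * X0 * mat_adjoint B2 \<preceq>\<^sub>L A2 \<and>
           (\<forall>X \<in> hermitian_mats n. B2 * X * mat_adjoint B2 \<preceq>\<^sub>L A2 \<longrightarrow>
              phi A1 B1 X0 \<preceq>\<^sub>L phi A1 B1 X) \<and>
           (\<exists>!P. loewner_least S P) \<and> loewner_min S = P0 \<and>
           int (i_plus P0) = int (i_plus (bordered_mat3 A1 A2 B1 B2)) - int (i_plus N) \<and>
           int (i_minus P0) = int (i_minus (bordered_mat3 A1 A2 B1 B2)) - int (i_minus N)))"
proof -
  let ?N = "bordered_mat A2 B2"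
  let ?K = "0\<^sub>m m2 m1 @\<^sub>r mat_adjoint B1"
  let ?G = "pinv ?N"
  let ?feas = "\<lambda>X. B2 * X * mat_adjoint B2 \<preceq>\<^sub>L A2"
  define X0 where "X0 = corner m2 n ?G"
  define P0 where "P0 = A1 - (0\<^sub>m m1 m2 @\<^sub>c B1) * ?G * ?K"
  define S where "S = {A1 - B1 * X * mat_adjoint B1 | X. ?feas X \<and> X \<in> hermitian_mats n}"
  obtain X where X: "X \<in> hermitian_mats n" "?feas X" using feasible by blast
  note B1' = adjoint_carrier[OF B1]
  note N = bordered_hermitian[OF A2 B2]
  note Nc = hermitian_carrier[OF N]
  note G = pinv_hermitian[OF N]
  note Gc = hermitian_carrier[OF G]
  have K: "?K \<in> carrier_mat (m2 + n) m1" using B1' by simp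
  have Kw: "?K *\<^sub>v w = 0\<^sub>v m2 @\<^sub>v (mat_adjoint B1 *\<^sub>v w)" if "w \<in> carrier_vec m1" for w
    by (rule zero_append_rows_mult_vec[OF B1' that])
  have X0: "X0 \<in> hermitian_mats n" unfolding X0_def by (rule corner_hermitian[OF G])
  have X0_feas: "?feas X0" unfolding X0_def by (rule corner_pinv_feasible[OF A2 B2 X])
  have range_iff: "mat_range ?K \<subseteq> mat_range ?N
    \<longleftrightarrow> (\<forall>w \<in> carrier_vec m1. 0\<^sub>v m2 @\<^sub>v (mat_adjoint B1 *\<^sub>v w) \<in> mat_range ?N)"
    using Kw by (auto simp: mem_mat_range_iff[OF K] subset_iff)
  have optimal: "phi A1 B1 X0 \<preceq>\<^sub>L phi A1 B1 Y"
    if range: "mat_range ?K \<subseteq> mat_range ?N" and Y: "Y \<in> hermitian_mats n" "?feas Y" for Y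
    using range feasible_le_corner_pinv[OF A2 B2 Y mult_mat_vec_carrier[OF B1'], folded X0_def]
    unfolding range_iff phi_le_iff_quad_form[OF A1 B1 X0 Y(1)] by blast
  have iff: "(\<exists>X0 \<in> hermitian_mats n. ?feas X0 \<and>
        (\<forall>X \<in> hermitian_mats n. ?feas X \<longrightarrow> phi A1 B1 X0 \<preceq>\<^sub>L phi A1 B1 X))
      \<longleftrightarrow> mat_range ?K \<subseteq> mat_range ?N"
    using range_condition_of_minimizer[OF A1 A2 B1 B2] X0 X0_feas optimal
    unfolding range_iff by blast
  have adj_K: "mat_adjoint ?K = 0\<^sub>m m1 m2 @\<^sub>c B1"
    using adjoint_zero_append_rows[of m2 B1] B1 by simp
  have E: "(0\<^sub>m m2 n @\<^sub>r 1\<^sub>m n :: complex mat) \<in> carrier_mat (m2 + n) n" by simp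
  have K_eq: "?K = (0\<^sub>m m2 n @\<^sub>r 1\<^sub>m n) * mat_adjoint B1"
  proof (rule eq_mat_of_mult_vec_eq[OF K])
    show "(0\<^sub>m m2 n @\<^sub>r 1\<^sub>m n) * mat_adjoint B1 \<in> carrier_mat (m2 + n) m1"
      by (rule mult_carrier_mat[OF E B1'])
    fix w :: "complex vec" assume w: "w \<in> carrier_vec m1"
    have c: "mat_adjoint B1 *\<^sub>v w \<in> carrier_vec n" by (rule mult_mat_vec_carrier[OF B1' w])
    show "?K *\<^sub>v w = (0\<^sub>m m2 n @\<^sub>r 1\<^sub>m n) * mat_adjoint B1 *\<^sub>v w"
      using zero_append_rows_mult_vec[OF one_carrier_mat c, of m2] c
      by (simp add: Kw[OF w] assoc_mult_mat_vec[OF E B1' w])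
  qed
  have adj_K_eq: "mat_adjoint ?K = B1 * mat_adjoint (0\<^sub>m m2 n @\<^sub>r 1\<^sub>m n)"
    unfolding K_eq using adjoint_mult[OF E B1'] by simp
  have P0_K: "P0 = A1 - mat_adjoint ?K * ?G * ?K" by (simp add: P0_def adj_K)
  have "B1 * X0 * mat_adjoint B1 = mat_adjoint ?K * ?G * ?K"
    using congruence_mult[OF B1 adjoint_carrier[OF E] Gc]
    by (simp only: X0_def corner_conv_congruence adjoint_adjoint flip: adj_K_eq)
  then have P0_phi: "P0 = phi A1 B1 X0" by (simp add: P0_K phi_def)
  have P0: "P0 \<in> hermitian_mats m1" unfolding P0_phi by (rule phi_hermitian[OF A1 B1 X0])
  have rest: "X0 \<in> hermitian_mats n \<and> ?feas X0 \<and>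
      (\<forall>X \<in> hermitian_mats n. ?feas X \<longrightarrow> phi A1 B1 X0 \<preceq>\<^sub>L phi A1 B1 X) \<and>
      (\<exists>!P. loewner_least S P) \<and> loewner_min S = P0 \<and>
      int (i_plus P0) = int (i_plus (bordered_mat3 A1 A2 B1 B2)) - int (i_plus ?N) \<and>
      int (i_minus P0) = int (i_minus (bordered_mat3 A1 A2 B1 B2)) - int (i_minus ?N)"
    if range: "mat_range ?K \<subseteq> mat_range ?N"
  proof -
    have least: "loewner_least S P0"
      unfolding loewner_least_def
    proof
      show "P0 \<in> S" unfolding S_def P0_phi phi_def using X0 X0_feas by blast
      show "\<forall>Q \<in> S. P0 \<preceq>\<^sub>L Q"
        unfolding S_def P0_phi using optimal[OF range] by (auto simp: phi_def)
    qed
    have unique: "P = P0" if "loewner_least S P" for P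
      using that least by (auto simp: loewner_least_def intro: loewner_antisym)
    have min: "loewner_min S = P0"
      unfolding loewner_min_def using least unique by (rule the_equality)
    \<comment> \<open>With this factor $T^{*}NT = K^{*}N^{\dagger}K$, the range condition gives $NT = K$, and so the full block matrix is congruent to the direct sum of the minimum and \<open>N\<close>.\<close>
    define T where "T = ?G * ?K"
    have T: "T \<in> carrier_mat (m2 + n) m1" using Gc K by (simp add: T_def)
    have NT: "?N * T = ?K"
    proof (rule eq_mat_of_mult_vec_eq[OF _ K])
      show "?N * T \<in> carrier_mat (m2 + n) m1" using Nc T by simp
      fix w :: "complex vec" assume w: "w \<in> carrier_vec m1"
      have "?N * T *\<^sub>v w = ?N *\<^sub>v (?G *\<^sub>v (?K *\<^sub>v w))"
        using assoc_mult_mat_vec[OF Nc T w] assoc_mult_mat_vec[OF Gc K w] by (simp add: T_def)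
      also have "\<dots> = ?K *\<^sub>v w"
        using mult_pinv_of_mem_range[OF N] range range_iff w by (simp add: Kw)
      finally show "?N * T *\<^sub>v w = ?K *\<^sub>v w" .
    qed
    have TN: "mat_adjoint T * ?N = mat_adjoint ?K"
      using adjoint_mult[OF Nc T] by (simp add: NT hermitian_adjoint[OF N])
    have TNT: "mat_adjoint T * ?N * T = mat_adjoint ?K * ?G * ?K"
      using assoc_mult_mat[OF adjoint_carrier[OF K] Gc K] by (simp only: TN) (simp add: T_def)
    have KGK: "mat_adjoint ?K * ?G * ?K \<in> carrier_mat m1 m1"
      using adjoint_carrier[OF K] Gc K by (metis mult_carrier_mat)
    have "P0 + mat_adjoint T * ?N * T = A1"
      unfolding P0_K TNT using hermitian_carrier[OF A1] KGK by (intro eq_matI) auto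
    then have M: "bordered_mat3 A1 A2 B1 B2
      = four_block_mat (P0 + mat_adjoint T * ?N * T) (mat_adjoint T * ?N) (?N * T) ?N"
      using hermitian_carrier[OF A1] hermitian_carrier[OF A2]
      by (simp add: bordered_mat3_def TN NT adj_K)
    note inertia = i_plus_minus_block_congruence[OF P0 N T, folded M]
    show ?thesis
    proof (intro conjI ballI impI)
      show "\<exists>!P. loewner_least S P" using least unique by (rule ex1I)
      show "int (i_plus P0) = int (i_plus (bordered_mat3 A1 A2 B1 B2)) - int (i_plus ?N)"
        unfolding inertia(1) by simp
      show "int (i_minus P0) = int (i_minus (bordered_mat3 A1 A2 B1 B2)) - int (i_minus ?N)"
        unfolding inertia(2) by simp
    qed (use X0 X0_feas min optimal[OF range] in blast)+
  qed
  show ?thesis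
    unfolding Let_def by (rule conjI[OF iff impI[OF rest[unfolded X0_def P0_def S_def corner_def]]])
qed

end
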